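(* Let $\mathbb{X},\mathbb{Y}$ be finite-dimensional real inner product spaces, let $f\colon\mathbb{X}\to\mathbb{X}$ be differentiable, let $\Phi\colon\mathbb{X}\to\mathbb{Y}$ be twice differentiable, and let $\Theta\subset\mathbb{Y}$ be closed. Put $\Psi(x,\lambda):=f(x)+\nabla\Phi(x)^*\lambda$, and let $(\bar x,\bar\lambda)\in\mathbb{X}\times\mathbb{Y}$ be a solution of the variational system $$\Psi(x,\lambda)=0,\qquad \lambda\in N_\Theta(\Phi(x)).$$ Let $\Lambda(\bar x):=\{\lambda\in\mathbb{Y}\mid \Psi(\bar x,\lambda)=0,\ \lambda\in N_\Theta(\Phi(\bar x))\}$ and let $S\colon\mathbb{X}\times\mathbb{Y}\rightrightarrows\mathbb{X}\times\mathbb{Y}$ be the solution map $$S(v,w):=\{(x,\lambda)\mid v=\Psi(x,\lambda),\ \lambda\in N_\Theta(\Phi(x)+w)\}.$$ Consider the following properties. (i) The Lagrange multiplier $\bar\lambda\in\Lambda(\bar x)$ is noncritical for the variational system. (ii) There are numbers $\varepsilon>0$, $\ell\ge 0$ and neighborhoods $V$ of $0\in\mathbb{X}$ and $W$ of $0\in\mathbb{Y}$ such that for any $(v,w)\in V\times W$ $$S(v,w)\cap\mathbb{B}_\varepsilon(\bar x,\bar\lambda)\subset\big[\{\bar x\}\times\Lambda(\bar x)\big]+\ell\big(\|v\|+\|w\|\big)\mathbb{B}.$$ (iii) There are numbers $\varepsilon>0$ and $\ell\ge 0$ such that $$\|x-\bar x\|+d\big(\lambda;\Lambda(\bar x)\big)\le\ell\Big(\|\Psi(x,\lambda)\|+d\big(\Phi(x);N_\Theta^{-1}(\lambda)\big)\Big)\quad\text{for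 all }(x,\lambda)\in\mathbb{B}_\varepsilon(\bar x,\bar\lambda).$$ Then: (a) The implications (iii)$\iff$(ii)$\implies$(i) always hold. (b) Let $\bar z:=\Phi(\bar x)$. If $\Theta$ is $\mathcal{C}^2$-cone reducible at $\bar z$ to a closed convex cone $C$, if the set $$K_\Theta(\bar z,\bar\lambda)^*-\big[K_\Theta(\bar z,\bar\lambda)^*\cap\ker\nabla\Phi(\bar x)^*\big]$$ is closed, and if the Lagrange multiplier mapping $M_{\bar x}\colon\mathbb{X}\times\mathbb{Y}\rightrightarrows\mathbb{Y}$, $M_{\bar x}(v,w):=\{\lambda\in\mathbb{Y}\mid v=\Psi(\bar x,\lambda),\ \lambda\in N_\Theta(\Phi(\bar x)+w)\}$, is calm at $((0,0),\bar\lambda)$, then the converse implication (i)$\implies$(ii) also holds.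
   Context: $\mathbb{B}$ is the closed unit ball of the space in question, $\mathbb{B}_r(x)=x+r\mathbb{B}$; $d(x;\Omega)$ is the distance from $x$ to $\Omega$ ($=\infty$ if $\Omega=\emptyset$). For a linear operator, $^*$ is the adjoint; for a set $\Omega$, $\Omega^*=\{v\mid\langle v,x\rangle\le 0\ \forall x\in\Omega\}$ is the polar. Tangent cone: $T_\Omega(\bar x)=\{w\mid\exists\,t_k\downarrow0,\ w_k\to w,\ \bar x+t_kw_k\in\Omega\}$ for $\bar x\in\Omega$. Regular normal cone: $\widehat N_\Omega(\bar x)=T_\Omega(\bar x)^*$. (Limiting) normal cone: $N_\Omega(\bar x)=\{v\mid\exists\,x_k\to\bar x,\ x_k\in\Omega,\ v_k\to v,\ v_k\in\widehat N_\Omega(x_k)\}$ for $\bar x\in\Omega$, and $N_\Omega(x)=\emptyset$ for $x\notin\Omega$. $N_\Theta^{-1}(\lambda)=\{z\mid\lambda\in N_\Theta(z)\}$. Graphical derivative of $F\colon\mathbb{X}\rightrightarrows\mathbb{Y}$ at $(\bar x,\bar y)\in\mathrm{gph}\,F$: $DF(\bar x,\bar y)(u)=\{v\mid(u,v)\in T_{\mathrm{gph}\,F}(\bar x,\bar y)\}$. Noncritical: $\bar\lambda\in\Lambda(\bar x)$ is noncritical if the only $\xi\in\mathbb{X}$ with $0\in\nabla_x\Psi(\bar x,\bar\lambda)\xi+\nabla\Phi(\bar x)^*DN_\Theta(\Phi(\bar x),\bar\lambda)(\nabla\Phi(\bar x)\xi)$ is $\xi=0$; otherwise it is critical. Critical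 cone: $K_\Theta(z,\lambda)=T_\Theta(z)\cap\{\lambda\}^\perp$ for $z\in\Theta$, $\lambda\in N_\Theta(z)$. $\mathcal{C}^2$-cone reducibility: a closed set $\Theta\subset\mathbb{Y}$ is $\mathcal{C}^2$-cone reducible at $\bar z\in\Theta$ to a closed convex cone $C\subset\mathbb{E}$ ($\mathbb{E}$ a finite-dimensional space) if there are a neighborhood $\mathcal{O}$ of $\bar z$ and a $\mathcal{C}^2$-smooth $h\colon\mathbb{Y}\to\mathbb{E}$ with $\Theta\cap\mathcal{O}=\{z\in\mathcal{O}\mid h(z)\in C\}$, $h(\bar z)=0$, and $\nabla h(\bar z)$ surjective. Calmness: $F$ is calm at $(\bar p,\bar q)\in\mathrm{gph}\,F$ if there are $\ell\ge0$ and neighborhoods $U$ of $\bar p$, $V$ of $\bar q$ with $F(p)\cap V\subset F(\bar p)+\ell\|p-\bar p\|\mathbb{B}$ for all $p\in U$. *)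

theory Defs
  imports "HOL-Analysis.Analysis"
begin

text \<open>
  \<open>A + B\<close> on sets is the Minkowski sum (from \<open>Set_Algebras\<close>), but \<open>A - B\<close> on sets is set difference,
  so the Minkowski difference needs its own constant. The scaled unit ball \<open>r\<bbbB>\<close> with \<open>r \<ge> 0\<close> is
  \<open>cball 0 r\<close>. ``\<open>U\<close> is a neighbourhood of \<open>p\<close>'' is \<open>p \<in> interior U\<close>.
\<close>

definition minkowski_diff :: "'a::ab_group_add set \<Rightarrow> 'a set \<Rightarrow> 'a set" where
  "minkowski_diff A B = {a - b |a b. a \<in> A \<and> b \<in> B}"

text \<open>Unlike \<^const>\<open>infdist\<close>, the distance to the empty set is infinite.\<close>

definition set_distance :: "'a::metric_space \<Rightarrow> 'a set \<Rightarrow> ereal" where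
  "set_distance x A = (if A = {} then \<infinity> else ereal (infdist x A))"


section \<open>Differentiability\<close>

abbreviation nabla :: "('a::real_normed_vector \<Rightarrow> 'b::real_normed_vector) \<Rightarrow> 'a \<Rightarrow> 'a \<Rightarrow> 'b" where
  "nabla F x \<equiv> frechet_derivative F (at x)"

definition twice_differentiable ::
    "('a::real_normed_vector \<Rightarrow> 'b::real_normed_vector) \<Rightarrow> bool" where
  "twice_differentiable F \<longleftrightarrow>
    (\<exists>F' :: 'a \<Rightarrow> 'a \<Rightarrow>\<^sub>L 'b. \<forall>x. (F has_derivative blinfun_apply (F' x)) (at x) \<and> F' differentiable (at x))"

definition C2_smooth :: "('a::real_normed_vector \<Rightarrow> 'b::real_normed_vector) \<Rightarrow> bool" where
  "C2_smooth F \<longleftrightarrow>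
    (\<exists>(F' :: 'a \<Rightarrow> 'a \<Rightarrow>\<^sub>L 'b) (F'' :: 'a \<Rightarrow> 'a \<Rightarrow>\<^sub>L 'a \<Rightarrow>\<^sub>L 'b).
      (\<forall>x. (F has_derivative blinfun_apply (F' x)) (at x)) \<and>
      (\<forall>x. (F' has_derivative blinfun_apply (F'' x)) (at x)) \<and>
      continuous_on UNIV F'')"


section \<open>Cones and generalized derivatives\<close>

definition polar :: "'a::real_inner set \<Rightarrow> 'a set" where
  "polar A = {v. \<forall>x\<in>A. inner v x \<le> 0}"

text \<open>The tangent cone is only meaningful, and only used, at points of the set.\<close>

definition tangent_cone :: "'a::real_normed_vector set \<Rightarrow> 'a \<Rightarrow> 'a set" where
  "tangent_cone A x =
    {w. \<exists>(t :: nat \<Rightarrow> real) ws. (\<forall>k. 0 < t k) \<and> t \<longlonglongrightarrow> 0 \<and> ws \<longlonglongrightarrow> w \<and> (\<forall>k. x + t k *\<^sub>R ws k \<in> A)}"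

definition regular_normal_cone :: "'a::real_inner set \<Rightarrow> 'a \<Rightarrow> 'a set" where
  "regular_normal_cone A x = polar (tangent_cone A x)"

definition normal_cone :: "'a::real_inner set \<Rightarrow> 'a \<Rightarrow> 'a set" where
  "normal_cone A x =
    {v. x \<in> A \<and> (\<exists>(xs :: nat \<Rightarrow> 'a) vs. xs \<longlonglongrightarrow> x \<and> (\<forall>k. xs k \<in> A) \<and>
          vs \<longlonglongrightarrow> v \<and> (\<forall>k. vs k \<in> regular_normal_cone A (xs k)))}"

definition normal_cone_inverse :: "'a::real_inner set \<Rightarrow> 'a \<Rightarrow> 'a set" where
  "normal_cone_inverse A v = {x. v \<in> normal_cone A x}"

definition critical_cone :: "'a::euclidean_space set \<Rightarrow> 'a \<Rightarrow> 'a \<Rightarrow> 'a set" where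
  "critical_cone A x v = tangent_cone A x \<inter> {v}\<^sup>\<bottom>"

definition gph :: "('a \<Rightarrow> 'b set) \<Rightarrow> ('a \<times> 'b) set" where
  "gph F = {(x, y). y \<in> F x}"

definition graphical_derivative ::
    "('a::real_normed_vector \<Rightarrow> 'b::real_normed_vector set) \<Rightarrow> 'a \<Rightarrow> 'b \<Rightarrow> 'a \<Rightarrow> 'b set" where
  "graphical_derivative F x y u = {v. (u, v) \<in> tangent_cone (gph F) (x, y)}"

definition calm_at ::
    "('a::real_normed_vector \<Rightarrow> 'b::real_normed_vector set) \<Rightarrow> 'a \<Rightarrow> 'b \<Rightarrow> bool" where
  "calm_at F p q \<longleftrightarrow> (p, q) \<in> gph F \<and>
    (\<exists>l\<ge>0. \<exists>U V. p \<in> interior U \<and> q \<in> interior V \<and>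
      (\<forall>p'\<in>U. F p' \<inter> V \<subseteq> F p + cball 0 (l * norm (p' - p))))"

definition C2_cone_reducible :: "'a::euclidean_space set \<Rightarrow> 'a \<Rightarrow> 'e::euclidean_space set \<Rightarrow> bool" where
  "C2_cone_reducible A z C \<longleftrightarrow>
    closed A \<and> z \<in> A \<and> closed C \<and> convex C \<and> cone C \<and>
    (\<exists>U (h :: 'a \<Rightarrow> 'e). z \<in> interior U \<and> C2_smooth h \<and>
      A \<inter> U = {y \<in> U. h y \<in> C} \<and> h z = 0 \<and> surj (nabla h z))"


section \<open>Variational systems\<close>

definition Psi ::
    "('x::euclidean_space \<Rightarrow> 'x) \<Rightarrow> ('x \<Rightarrow> 'y::euclidean_space) \<Rightarrow> 'x \<Rightarrow> 'y \<Rightarrow> 'x" where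
  "Psi f \<Phi> x \<mu> = f x + adjoint (nabla \<Phi> x) \<mu>"

definition solves_variational_system ::
    "('x::euclidean_space \<Rightarrow> 'x) \<Rightarrow> ('x \<Rightarrow> 'y::euclidean_space) \<Rightarrow> 'y set \<Rightarrow> 'x \<Rightarrow> 'y \<Rightarrow> bool" where
  "solves_variational_system f \<Phi> \<Theta> x \<mu> \<longleftrightarrow> Psi f \<Phi> x \<mu> = 0 \<and> \<mu> \<in> normal_cone \<Theta> (\<Phi> x)"

definition multipliers ::
    "('x::euclidean_space \<Rightarrow> 'x) \<Rightarrow> ('x \<Rightarrow> 'y::euclidean_space) \<Rightarrow> 'y set \<Rightarrow> 'x \<Rightarrow> 'y set" where
  "multipliers f \<Phi> \<Theta> x = {\<mu>. Psi f \<Phi> x \<mu> = 0 \<and> \<mu> \<in> normal_cone \<Theta> (\<Phi> x)}"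

definition solution_map ::
    "('x::euclidean_space \<Rightarrow> 'x) \<Rightarrow> ('x \<Rightarrow> 'y::euclidean_space) \<Rightarrow> 'y set \<Rightarrow> 'x \<times> 'y \<Rightarrow> ('x \<times> 'y) set" where
  "solution_map f \<Phi> \<Theta> = (\<lambda>(v, w). {(x, \<mu>). v = Psi f \<Phi> x \<mu> \<and> \<mu> \<in> normal_cone \<Theta> (\<Phi> x + w)})"

definition multiplier_map ::
    "('x::euclidean_space \<Rightarrow> 'x) \<Rightarrow> ('x \<Rightarrow> 'y::euclidean_space) \<Rightarrow> 'y set \<Rightarrow> 'x \<Rightarrow> 'x \<times> 'y \<Rightarrow> 'y set" where
  "multiplier_map f \<Phi> \<Theta> x = (\<lambda>(v, w). {\<mu>. v = Psi f \<Phi> x \<mu> \<and> \<mu> \<in> normal_cone \<Theta> (\<Phi> x + w)})"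

definition noncritical ::
    "('x::euclidean_space \<Rightarrow> 'x) \<Rightarrow> ('x \<Rightarrow> 'y::euclidean_space) \<Rightarrow> 'y set \<Rightarrow> 'x \<Rightarrow> 'y \<Rightarrow> bool" where
  "noncritical f \<Phi> \<Theta> x \<mu> \<longleftrightarrow> \<mu> \<in> multipliers f \<Phi> \<Theta> x \<and>
    (\<forall>\<xi>. 0 \<in> (\<lambda>\<eta>. nabla (\<lambda>u. Psi f \<Phi> u \<mu>) x \<xi> + adjoint (nabla \<Phi> x) \<eta>) `
              graphical_derivative (normal_cone \<Theta>) (\<Phi> x) \<mu> (nabla \<Phi> x \<xi>)
          \<longrightarrow> \<xi> = 0)"

definition semi_isolated_calm ::
    "('x::euclidean_space \<Rightarrow> 'x) \<Rightarrow> ('x \<Rightarrow> 'y::euclidean_space) \<Rightarrow> 'y set \<Rightarrow> 'x \<Rightarrow> 'y \<Rightarrow> bool" where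
  "semi_isolated_calm f \<Phi> \<Theta> x \<mu> \<longleftrightarrow>
    (\<exists>\<epsilon>>0. \<exists>l\<ge>0. \<exists>V W. 0 \<in> interior V \<and> 0 \<in> interior W \<and>
      (\<forall>(v, w) \<in> V \<times> W.
        solution_map f \<Phi> \<Theta> (v, w) \<inter> cball (x, \<mu>) \<epsilon>
          \<subseteq> {x} \<times> multipliers f \<Phi> \<Theta> x + cball 0 (l * (norm v + norm w))))"

text \<open>
  When \<open>l = 0\<close> and the last distance is infinite, \<^typ>\<open>ereal\<close> multiplication yields \<open>0\<close>; this does not
  affect the property, since \<open>l\<close> may always be enlarged.
\<close>

definition error_bound ::
    "('x::euclidean_space \<Rightarrow> 'x) \<Rightarrow> ('x \<Rightarrow> 'y::euclidean_space) \<Rightarrow> 'y set \<Rightarrow> 'x \<Rightarrow> 'y \<Rightarrow> bool" where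
  "error_bound f \<Phi> \<Theta> x \<mu> \<longleftrightarrow>
    (\<exists>\<epsilon>>0. \<exists>l\<ge>0. \<forall>(x', \<mu>') \<in> cball (x, \<mu>) \<epsilon>.
      ereal (norm (x' - x)) + set_distance \<mu>' (multipliers f \<Phi> \<Theta> x)
        \<le> ereal l * (ereal (norm (Psi f \<Phi> x' \<mu>')) + set_distance (\<Phi> x') (normal_cone_inverse \<Theta> \<mu>')))"

end

theory Submission
  imports Defs
begin

text \<open>
  That (ii) implies (iii) follows by projecting \<open>\<Phi> x\<close> onto the closed set \<open>N\<^sub>\<Theta>\<inverse>(\<lambda>)\<close>. For (ii) \<open>\<Longrightarrow>\<close> (i), the sequences
  witnessing \<open>\<eta> \<in> DN\<^sub>\<Theta>(\<nabla>\<Phi>(xbar)\<xi>)\<close> produce points of \<open>S(v\<^sub>k, w\<^sub>k)\<close> with \<open>v\<^sub>k, w\<^sub>k = o(t\<^sub>k)\<close> at distance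
  \<open>t\<^sub>k \<parallel>\<xi>\<parallel>\<close> from \<open>xbar\<close>.

  For the converse, suppose (ii) fails along \<open>(x\<^sub>k, \<lambda>\<^sub>k)\<close> and put \<open>t\<^sub>k = \<parallel>x\<^sub>k - xbar\<parallel>\<close>. Calmness of the multiplier map
  gives \<open>\<nu>\<^sub>k \<in> \<Lambda>(xbar)\<close> with \<open>\<lambda>\<^sub>k - \<nu>\<^sub>k = O(t\<^sub>k)\<close> and \<open>v\<^sub>k, w\<^sub>k = o(t\<^sub>k)\<close>, so that in the limit
  \<open>\<nabla>\<^sub>x\<Psi> \<xi> + \<nabla>\<Phi>\<^sup>* \<eta> = 0\<close> with \<open>\<parallel>\<xi>\<parallel> = 1\<close>. Writing \<open>\<lambda>\<^sub>k = \<nabla>h(z\<^sub>k)\<^sup>*\<rho>\<^sub>k\<close> and \<open>\<nu>\<^sub>k = \<nabla>h(zbar)\<^sup>*\<sigma>\<^sub>k\<close> through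
  the cone reduction, \<open>\<eta>\<close> is a second-order term plus a limit of elements of \<open>K\<^sup>* - (K\<^sup>* \<inter> ker \<nabla>\<Phi>\<^sup>*)\<close>.
  By closedness this limit is \<open>a - b\<close>; dropping \<open>b\<close> does not change \<open>\<nabla>\<Phi>\<^sup>* \<eta>\<close> and moves \<open>\<eta>\<close> into the
  graphical derivative, contradicting noncriticality.
\<close>

section \<open>Adjoints, difference quotients and normal cones\<close>

text \<open>Taking the operator as a \<open>blinfun\<close> makes the adjoint bilinear in operator
  and vector jointly, so limits and derivatives of \<open>adj (T k) (y k)\<close> follow from the
  generic rules for bounded bilinear maps.\<close>

definition adj :: "('a::euclidean_space \<Rightarrow>\<^sub>L 'b::euclidean_space) \<Rightarrow> 'b \<Rightarrow> 'a" where
  "adj T = adjoint (blinfun_apply T)"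

lemma inner_adj: "x \<bullet> adj T y = blinfun_apply T x \<bullet> y"
  by (simp add: adj_def adjoint_works blinfun.bounded_linear_right bounded_linear.linear)

lemma adj_inner: "adj T y \<bullet> x = y \<bullet> blinfun_apply T x"
  by (metis inner_adj inner_commute)

lemma adj_eqI: "(\<And>x. blinfun_apply T x \<bullet> y = x \<bullet> z) \<Longrightarrow> adj T y = z"
  by (metis inner_adj vector_eq_rdot inner_commute)

lemma norm_adj_le: "norm (adj T y) \<le> norm T * norm y"
proof (cases "adj T y = 0")
  case False
  have "norm (adj T y) * norm (adj T y) = blinfun_apply T (adj T y) \<bullet> y"
    by (metis inner_adj power2_eq_square power2_norm_eq_inner)
  also have "\<dots> \<le> norm (blinfun_apply T (adj T y)) * norm y"
    by (rule norm_cauchy_schwarz)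
  also have "\<dots> \<le> (norm T * norm (adj T y)) * norm y"
    by (intro mult_right_mono norm_blinfun) auto
  finally have "norm (adj T y) * norm (adj T y) \<le> (norm T * norm y) * norm (adj T y)"
    by (simp add: mult_ac)
  then show ?thesis
    using False by simp
qed simp

lemma bounded_bilinear_adj: "bounded_bilinear adj"
proof
  show "\<exists>K. \<forall>T y. norm (adj T y) \<le> norm T * norm y * K"
    by (metis norm_adj_le mult.right_neutral)
qed (auto intro!: adj_eqI simp: inner_adj blinfun.bilinear_simps inner_add_left inner_add_right)

interpretation adj: bounded_bilinear adj
  by (rule bounded_bilinear_adj)

text \<open>Frechet differentiability is uniform over bounded sets of directions, so the direction
  \<open>u k\<close> may vary with the step \<open>t k\<close>, as it does in tangent
  sequences.\<close>

lemma has_derivative_sequence_quotient: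
  fixes g :: "'a::real_normed_vector \<Rightarrow> 'b::real_normed_vector"
  assumes g: "(g has_derivative g') (at x)"
    and t: "t \<longlonglongrightarrow> 0" "\<And>k. 0 < t k" and u: "u \<longlonglongrightarrow> u0"
  shows "(\<lambda>k. (g (x + t k *\<^sub>R u k) - g x) /\<^sub>R t k) \<longlonglongrightarrow> g' u0"
proof -
  have bl: "bounded_linear g'"
    using g by (rule has_derivative_bounded_linear)
  interpret g': bounded_linear g' by (rule bl)
  \<comment> \<open>Division by zero yields zero, so \<open>r 0 = 0\<close> and differentiability at
    \<open>x\<close> becomes continuity of \<open>r\<close> at the origin.\<close>
  define r where "r h = norm (g (x + h) - g x - g' h) / norm h" for h
  have "isCont r 0"
    using g unfolding has_derivative_at isCont_def r_def by simp
  moreover have "(\<lambda>k. t k *\<^sub>R u k) \<longlonglongrightarrow> 0"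
    using tendsto_scaleR[OF t(1) u] by simp
  ultimately have "(\<lambda>k. r (t k *\<^sub>R u k)) \<longlonglongrightarrow> r 0"
    by (rule isCont_tendsto_compose)
  then have "(\<lambda>k. r (t k *\<^sub>R u k) * norm (u k)) \<longlonglongrightarrow> 0"
    using tendsto_mult[OF _ tendsto_norm[OF u]] by (fastforce simp: r_def)
  moreover have "norm ((g (x + t k *\<^sub>R u k) - g x) /\<^sub>R t k - g' (u k)) = r (t k *\<^sub>R u k) * norm (u k)" for k
  proof (cases "u k = 0")
    case False
    have "(g (x + t k *\<^sub>R u k) - g x) /\<^sub>R t k - g' (u k)
        = (g (x + t k *\<^sub>R u k) - g x - g' (t k *\<^sub>R u k)) /\<^sub>R t k"
      using t(2)[of k] by (simp add: g'.scaleR scaleR_diff_right)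
    then show ?thesis
      using t(2)[of k] False by (simp add: r_def divide_inverse)
  qed (simp add: r_def g'.zero)
  ultimately have "(\<lambda>k. (g (x + t k *\<^sub>R u k) - g x) /\<^sub>R t k - g' (u k)) \<longlonglongrightarrow> 0"
    by - (rule tendsto_norm_zero_cancel, simp)
  from tendsto_add[OF this g'.tendsto[OF u]] show ?thesis
    by simp
qed

text \<open>Diagonal argument: each limiting normal \<open>v k\<close> is replaced by a regular
  normal at a nearby point of \<open>A\<close>, with both errors below 1/(k+1), so the limits do not
  change.\<close>

lemma closed_graph_normal_cone:
  assumes "closed A" and z: "z \<longlonglongrightarrow> z0" and v: "v \<longlonglongrightarrow> v0"
    and mem: "\<And>k. v k \<in> normal_cone A (z k)"
  shows "v0 \<in> normal_cone A z0"
proof -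
  have "\<exists>y w. y \<in> A \<and> w \<in> regular_normal_cone A y \<and> dist y (z k) < inverse (real (Suc k))
      \<and> dist w (v k) < inverse (real (Suc k))" for k
  proof -
    obtain ys ws where ys: "ys \<longlonglongrightarrow> z k" "\<And>j. ys j \<in> A" and ws: "ws \<longlonglongrightarrow> v k"
      "\<And>j. ws j \<in> regular_normal_cone A (ys j)"
      using mem[of k] unfolding normal_cone_def by blast
    have "\<forall>\<^sub>F j in sequentially. dist (ys j) (z k) < inverse (real (Suc k))
        \<and> dist (ws j) (v k) < inverse (real (Suc k))"
      by (intro eventually_conj tendstoD[OF ys(1)] tendstoD[OF ws(1)]) auto
    from eventually_happens'[OF sequentially_bot this] show ?thesis
      using ys(2) ws(2) by blast
  qed
  then obtain y w where yw: "\<And>k. y k \<in> A" "\<And>k. w k \<in> regular_normal_cone A (y k)"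
    "\<And>k. dist (y k) (z k) < inverse (real (Suc k))" "\<And>k. dist (w k) (v k) < inverse (real (Suc k))"
    by metis
  have "(\<lambda>k. y k - z k) \<longlonglongrightarrow> 0" "(\<lambda>k. w k - v k) \<longlonglongrightarrow> 0"
    using yw(3,4) by (auto intro!: Lim_null_comparison[OF _ LIMSEQ_inverse_real_of_nat] less_imp_le always_eventually
        simp: dist_norm)
  from tendsto_add[OF this(1) z] tendsto_add[OF this(2) v]
  have lim: "y \<longlonglongrightarrow> z0" "w \<longlonglongrightarrow> v0" by auto
  have "z0 \<in> A"
    using \<open>closed A\<close> yw(1) lim(1) by (rule closed_sequentially)
  with lim yw show ?thesis
    unfolding normal_cone_def by blast
qed

lemma mem_normal_cone_base: "v \<in> normal_cone A x \<Longrightarrow> x \<in> A"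
  by (simp add: normal_cone_def)

lemma twice_differentiableE:
  assumes "twice_differentiable F"
  obtains F' :: "'a::real_normed_vector \<Rightarrow> 'a \<Rightarrow>\<^sub>L 'b::real_normed_vector"
  where "\<And>x. (F has_derivative blinfun_apply (F' x)) (at x)" "\<And>x. F' differentiable (at x)"
  using assms unfolding twice_differentiable_def by blast

section \<open>Semi-isolated calmness, error bounds and noncriticality\<close>

text \<open>The derivative of \<open>\<Phi>\<close> is a parameter with values in bounded operators,
  so that its own differentiability can be stated and \<open>adj\<close> applies to it.\<close>

locale variational_system =
  fixes f :: "'x::euclidean_space \<Rightarrow> 'x"
    and \<Phi> :: "'x \<Rightarrow> 'y::euclidean_space"
    and \<Phi>' :: "'x \<Rightarrow> 'x \<Rightarrow>\<^sub>L 'y"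
    and \<Theta> :: "'y set"
    and xbar :: 'x and \<mu>bar :: 'y
  assumes f_diff: "\<And>x. f differentiable (at x)"
    and \<Phi>_deriv: "\<And>x. (\<Phi> has_derivative blinfun_apply (\<Phi>' x)) (at x)"
    and \<Phi>'_diff: "\<And>x. \<Phi>' differentiable (at x)"
    and closed_\<Theta>: "closed \<Theta>"
    and solution: "\<mu>bar \<in> multipliers f \<Phi> \<Theta> xbar"
begin

lemma nabla_\<Phi>: "nabla \<Phi> x = blinfun_apply (\<Phi>' x)"
  using \<Phi>_deriv by (metis frechet_derivative_at)

lemma Psi_eq: "Psi f \<Phi> x \<mu> = f x + adj (\<Phi>' x) \<mu>"
  by (simp add: Psi_def adj_def nabla_\<Phi>)

lemma Psi_diff_multiplier: "Psi f \<Phi> x \<mu> - Psi f \<Phi> x \<nu> = adj (\<Phi>' x) (\<mu> - \<nu>)"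
  by (simp add: Psi_eq adj.diff_right)

lemma tendsto_Psi:
  assumes "(x \<longlongrightarrow> x0) F" "(\<mu> \<longlongrightarrow> \<mu>0) F"
  shows "((\<lambda>k. Psi f \<Phi> (x k) (\<mu> k)) \<longlongrightarrow> Psi f \<Phi> x0 \<mu>0) F"
  unfolding Psi_eq
  using differentiable_imp_continuous_within[OF f_diff[of x0]] differentiable_imp_continuous_within[OF \<Phi>'_diff[of x0]]
  by (intro tendsto_add adj.tendsto assms isCont_tendsto_compose[OF _ assms(1)]) auto

lemma tendsto_\<Phi>: "(x \<longlongrightarrow> x0) F \<Longrightarrow> ((\<lambda>k. \<Phi> (x k)) \<longlongrightarrow> \<Phi> x0) F"
  using has_derivative_continuous[OF \<Phi>_deriv[of x0]] isCont_tendsto_compose by blast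

lemma Psi_differentiable: "(\<lambda>u. Psi f \<Phi> u \<mu>) differentiable (at x)"
proof -
  obtain f' \<Phi>'' where "(f has_derivative f') (at x)" "(\<Phi>' has_derivative \<Phi>'') (at x)"
    using f_diff \<Phi>'_diff unfolding differentiable_def by meson
  then have "((\<lambda>u. Psi f \<Phi> u \<mu>) has_derivative (\<lambda>\<xi>. f' \<xi> + (adj (\<Phi>' x) 0 + adj (\<Phi>'' \<xi>) \<mu>))) (at x)"
    unfolding Psi_eq by (intro has_derivative_add adj.FDERIV has_derivative_const)
  then show ?thesis
    by (auto simp: differentiable_def)
qed

lemma Psi_deriv:
  "((\<lambda>u. Psi f \<Phi> u \<mu>) has_derivative nabla (\<lambda>u. Psi f \<Phi> u \<mu>) x) (at x)"
  using Psi_differentiable frechet_derivative_works by blast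

text \<open>\<open>Psi\<close> is affine in the multiplier: replacing \<open>\<mu> k\<close> by
  \<open>\<mu>0\<close> changes the quotient only by the difference quotient of
  \<open>\<Phi>'\<close> paired with \<open>\<mu> k - \<mu>0\<close>, which tends to zero.\<close>

lemma Psi_quotient:
  assumes t: "t \<longlonglongrightarrow> 0" "\<And>k. 0 < t k" and \<xi>: "\<xi> \<longlonglongrightarrow> \<xi>0" and \<mu>: "\<mu> \<longlonglongrightarrow> \<mu>0"
  shows "(\<lambda>k. (Psi f \<Phi> (x + t k *\<^sub>R \<xi> k) (\<mu> k) - Psi f \<Phi> x (\<mu> k)) /\<^sub>R t k)
     \<longlonglongrightarrow> nabla (\<lambda>u. Psi f \<Phi> u \<mu>0) x \<xi>0"
proof -
  obtain \<Phi>'' where \<Phi>'': "(\<Phi>' has_derivative \<Phi>'') (at x)"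
    using \<Phi>'_diff unfolding differentiable_def by meson
  have "(\<lambda>k. (Psi f \<Phi> (x + t k *\<^sub>R \<xi> k) \<mu>0 - Psi f \<Phi> x \<mu>0) /\<^sub>R t k
      + adj ((\<Phi>' (x + t k *\<^sub>R \<xi> k) - \<Phi>' x) /\<^sub>R t k) (\<mu> k - \<mu>0))
      \<longlonglongrightarrow> nabla (\<lambda>u. Psi f \<Phi> u \<mu>0) x \<xi>0 + adj (\<Phi>'' \<xi>0) (\<mu>0 - \<mu>0)"
    by (intro tendsto_add adj.tendsto tendsto_diff \<mu> tendsto_const
        has_derivative_sequence_quotient[OF Psi_deriv t \<xi>] has_derivative_sequence_quotient[OF \<Phi>'' t \<xi>])
  then show ?thesis
    by (simp add: Psi_eq adj.scaleR_left adj.diff_left adj.diff_right adj.zero_right algebra_simps)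
qed

lemma Lambda_closed: "closed (multipliers f \<Phi> \<Theta> xbar)"
proof (unfold closed_sequential_limits, intro allI impI, elim conjE)
  fix \<mu> l assume "\<forall>n. \<mu> n \<in> multipliers f \<Phi> \<Theta> xbar" and l: "\<mu> \<longlonglongrightarrow> l"
  then have mem: "Psi f \<Phi> xbar (\<mu> n) = 0" "\<mu> n \<in> normal_cone \<Theta> (\<Phi> xbar)" for n
    by (auto simp: multipliers_def)
  have "l \<in> normal_cone \<Theta> (\<Phi> xbar)"
    by (rule closed_graph_normal_cone[OF closed_\<Theta> tendsto_const l mem(2)])
  moreover have "Psi f \<Phi> xbar l = 0"
    using tendsto_Psi[OF tendsto_const l, of xbar] mem(1) by (simp add: LIMSEQ_const_iff)
  ultimately show "l \<in> multipliers f \<Phi> \<Theta> xbar"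
    by (simp add: multipliers_def)
qed

lemma closed_normal_cone_inverse: "closed (normal_cone_inverse \<Theta> \<mu>)"
  unfolding closed_sequential_limits normal_cone_inverse_def
  using closed_graph_normal_cone[OF closed_\<Theta> _ tendsto_const] by blast

section \<open>Equivalence of the error bound and semi-isolated calmness\<close>

lemma mem_Lambda_plus_cballI:
  assumes le: "norm (x - xbar) + infdist \<mu> (multipliers f \<Phi> \<Theta> xbar) \<le> r"
  shows "(x, \<mu>) \<in> {xbar} \<times> multipliers f \<Phi> \<Theta> xbar + cball 0 r"
proof -
  \<comment> \<open>The multiplier set is closed and nonempty, so a nearest multiplier exists; the
    displacement from \<open>(xbar, \<nu>)\<close> is at most the sum of its two components.\<close>
  obtain \<nu> where \<nu>: "\<nu> \<in> multipliers f \<Phi> \<Theta> xbar" "infdist \<mu> (multipliers f \<Phi> \<Theta> xbar) = dist \<mu> \<nu>"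
    using infdist_attains_inf[OF Lambda_closed, of \<mu>] solution by blast
  have "norm (x - xbar, \<mu> - \<nu>) \<le> norm (x - xbar) + norm (\<mu> - \<nu>)"
    by (simp add: norm_Pair sqrt_sum_squares_le_sum)
  then have "(x - xbar, \<mu> - \<nu>) \<in> cball 0 r"
    using le \<nu>(2) by (simp add: dist_norm[of \<mu>])
  moreover have "(x, \<mu>) = (xbar, \<nu>) + (x - xbar, \<mu> - \<nu>)"
    by simp
  ultimately show ?thesis
    using \<nu>(1) by (metis set_plus_intro mem_Sigma_iff singletonI)
qed

text \<open>For a solution at \<open>(v, w)\<close> the point \<open>\<Phi> x + w\<close> lies in
  the inverse normal cone, so \<open>norm w\<close> dominates the distance term. Both neighbourhoods
  can be the whole space.\<close>

lemma error_bound_imp_semi_isolated_calm: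
  assumes "error_bound f \<Phi> \<Theta> xbar \<mu>bar"
  shows "semi_isolated_calm f \<Phi> \<Theta> xbar \<mu>bar"
proof -
  let ?L = "multipliers f \<Phi> \<Theta> xbar"
  obtain \<epsilon> l where "\<epsilon> > 0" "l \<ge> 0" and eb: "\<And>x \<mu>. (x, \<mu>) \<in> cball (xbar, \<mu>bar) \<epsilon> \<Longrightarrow>
      ereal (norm (x - xbar)) + set_distance \<mu> ?L
        \<le> ereal l * (ereal (norm (Psi f \<Phi> x \<mu>)) + set_distance (\<Phi> x) (normal_cone_inverse \<Theta> \<mu>))"
    using assms unfolding error_bound_def by blast
  have "solution_map f \<Phi> \<Theta> (v, w) \<inter> cball (xbar, \<mu>bar) \<epsilon>
      \<subseteq> {xbar} \<times> ?L + cball 0 (l * (norm v + norm w))" for v w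
  proof clarify
    fix x \<mu> assume sol: "(x, \<mu>) \<in> solution_map f \<Phi> \<Theta> (v, w)" and "(x, \<mu>) \<in> cball (xbar, \<mu>bar) \<epsilon>"
    then have v: "v = Psi f \<Phi> x \<mu>" and w: "\<Phi> x + w \<in> normal_cone_inverse \<Theta> \<mu>"
      by (auto simp: solution_map_def normal_cone_inverse_def)
    have "infdist (\<Phi> x) (normal_cone_inverse \<Theta> \<mu>) \<le> norm w"
      using infdist_le[OF w, of "\<Phi> x"] by (simp add: dist_norm)
    then have "l * (norm v + infdist (\<Phi> x) (normal_cone_inverse \<Theta> \<mu>)) \<le> l * (norm v + norm w)"
      using \<open>l \<ge> 0\<close> by (intro mult_left_mono) auto
    moreover have "ereal (norm (x - xbar)) + ereal (infdist \<mu> ?L)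
        \<le> ereal l * (ereal (norm v) + ereal (infdist (\<Phi> x) (normal_cone_inverse \<Theta> \<mu>)))"
      using eb[OF \<open>(x, \<mu>) \<in> cball (xbar, \<mu>bar) \<epsilon>\<close>] solution w v by (auto simp: set_distance_def split: if_splits)
    ultimately have "norm (x - xbar) + infdist \<mu> ?L \<le> l * (norm v + norm w)"
      by simp
    then show "(x, \<mu>) \<in> {xbar} \<times> ?L + cball 0 (l * (norm v + norm w))"
      by (rule mem_Lambda_plus_cballI)
  qed
  then show ?thesis
    unfolding semi_isolated_calm_def using \<open>\<epsilon> > 0\<close> \<open>l \<ge> 0\<close>
    by (intro exI[of _ \<epsilon>] exI[of _ l] exI[of _ UNIV] conjI) auto
qed

lemma mem_Lambda_plus_cballD:
  assumes "(x, \<mu>) \<in> {xbar} \<times> multipliers f \<Phi> \<Theta> xbar + cball 0 r"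
  shows "norm (x - xbar) \<le> r" "infdist \<mu> (multipliers f \<Phi> \<Theta> xbar) \<le> r"
proof -
  obtain p q where "p \<in> {xbar} \<times> multipliers f \<Phi> \<Theta> xbar" "q \<in> cball 0 r" "(x, \<mu>) = p + q"
    using assms by (rule set_plus_elim)
  then obtain \<nu> a b where "\<nu> \<in> multipliers f \<Phi> \<Theta> xbar" "x = xbar + a" "\<mu> = \<nu> + b" "norm (a, b) \<le> r"
    by (cases p; cases q) auto
  moreover have "norm a \<le> norm (a, b)" "norm b \<le> norm (a, b)"
    by (auto simp: norm_Pair)
  ultimately show "norm (x - xbar) \<le> r" "infdist \<mu> (multipliers f \<Phi> \<Theta> xbar) \<le> r"
    using infdist_le[of \<nu> "multipliers f \<Phi> \<Theta> xbar" \<mu>] by (auto simp: dist_norm)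
qed

text \<open>The form suited to sequences: one radius replaces the ball and both neighbourhoods, and
  the set inclusion is split into a bound for each component.\<close>

lemma semi_isolated_calmE:
  assumes "semi_isolated_calm f \<Phi> \<Theta> xbar \<mu>bar"
  obtains l r where "l \<ge> 0" "r > 0"
    "\<And>x \<mu> w. \<lbrakk>dist (x, \<mu>) (xbar, \<mu>bar) < r; norm (Psi f \<Phi> x \<mu>) < r; norm w < r;
       \<mu> \<in> normal_cone \<Theta> (\<Phi> x + w)\<rbrakk>
      \<Longrightarrow> norm (x - xbar) \<le> l * (norm (Psi f \<Phi> x \<mu>) + norm w)
        \<and> infdist \<mu> (multipliers f \<Phi> \<Theta> xbar) \<le> l * (norm (Psi f \<Phi> x \<mu>) + norm w)"
proof -
  obtain \<epsilon> l V W where e: "\<epsilon> > 0" "l \<ge> 0" and VW: "0 \<in> interior V" "0 \<in> interior W"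
    and incl: "\<And>v w. v \<in> V \<Longrightarrow> w \<in> W \<Longrightarrow> solution_map f \<Phi> \<Theta> (v, w) \<inter> cball (xbar, \<mu>bar) \<epsilon>
          \<subseteq> {xbar} \<times> multipliers f \<Phi> \<Theta> xbar + cball 0 (l * (norm v + norm w))"
    using assms unfolding semi_isolated_calm_def by (smt (verit) case_prodD mem_Sigma_iff)
  obtain r1 r2 where r: "r1 > 0" "r2 > 0" "ball 0 r1 \<subseteq> V" "ball 0 r2 \<subseteq> W"
    using VW mem_interior by metis
  show thesis
  proof (rule that[of l "min \<epsilon> (min r1 r2)"])
    fix x \<mu> w
    assume *: "dist (x, \<mu>) (xbar, \<mu>bar) < min \<epsilon> (min r1 r2)" "norm (Psi f \<Phi> x \<mu>) < min \<epsilon> (min r1 r2)"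
      "norm w < min \<epsilon> (min r1 r2)" "\<mu> \<in> normal_cone \<Theta> (\<Phi> x + w)"
    then have "Psi f \<Phi> x \<mu> \<in> V" "w \<in> W"
      using r(3,4) by (auto simp: subset_iff)
    moreover have "(x, \<mu>) \<in> solution_map f \<Phi> \<Theta> (Psi f \<Phi> x \<mu>, w) \<inter> cball (xbar, \<mu>bar) \<epsilon>"
      using * by (auto simp: solution_map_def dist_commute)
    ultimately show "norm (x - xbar) \<le> l * (norm (Psi f \<Phi> x \<mu>) + norm w)
        \<and> infdist \<mu> (multipliers f \<Phi> \<Theta> xbar) \<le> l * (norm (Psi f \<Phi> x \<mu>) + norm w)"
      using incl mem_Lambda_plus_cballD by blast
  qed (use e r in auto)
qed

text \<open>If the distance to the inverse normal cone is below the calmness radius, a nearest point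
  supplies the perturbation \<open>w\<close>. Otherwise that distance already exceeds each term on
  the left.\<close>

lemma semi_isolated_calm_imp_error_bound:
  assumes "semi_isolated_calm f \<Phi> \<Theta> xbar \<mu>bar"
  shows "error_bound f \<Phi> \<Theta> xbar \<mu>bar"
proof -
  let ?L = "multipliers f \<Phi> \<Theta> xbar"
  let ?N = "normal_cone_inverse \<Theta>"
  obtain l r where "l \<ge> 0" "r > 0" and
    calm: "\<And>x \<mu> w. \<lbrakk>dist (x, \<mu>) (xbar, \<mu>bar) < r; norm (Psi f \<Phi> x \<mu>) < r; norm w < r;
       \<mu> \<in> normal_cone \<Theta> (\<Phi> x + w)\<rbrakk>
      \<Longrightarrow> norm (x - xbar) \<le> l * (norm (Psi f \<Phi> x \<mu>) + norm w)
        \<and> infdist \<mu> ?L \<le> l * (norm (Psi f \<Phi> x \<mu>) + norm w)"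
    using semi_isolated_calmE[OF assms] by metis
  have "((\<lambda>p. Psi f \<Phi> (fst p) (snd p)) \<longlongrightarrow> Psi f \<Phi> (fst (xbar, \<mu>bar)) (snd (xbar, \<mu>bar))) (nhds (xbar, \<mu>bar))"
    by (intro tendsto_Psi tendsto_fst tendsto_snd filterlim_ident)
  moreover have "Psi f \<Phi> xbar \<mu>bar = 0"
    using solution by (simp add: multipliers_def)
  ultimately have "((\<lambda>p. Psi f \<Phi> (fst p) (snd p)) \<longlongrightarrow> 0) (nhds (xbar, \<mu>bar))"
    by simp
  then have "\<forall>\<^sub>F p in nhds (xbar, \<mu>bar). norm (Psi f \<Phi> (fst p) (snd p)) < r"
    using order_tendstoD(2)[OF tendsto_norm_zero] \<open>r > 0\<close> by blast
  then obtain d where d: "d > 0" "\<And>x \<mu>. dist (x, \<mu>) (xbar, \<mu>bar) < d \<Longrightarrow> norm (Psi f \<Phi> x \<mu>) < r"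
    unfolding eventually_nhds_metric by (metis fst_conv snd_conv)
  \<comment> \<open>Halving puts the closed ball of radius \<open>\<epsilon>\<close> inside both
    open balls, of radius \<open>d\<close> and \<open>r\<close>.\<close>
  define \<epsilon> where "\<epsilon> = min d r / 2"
  have \<epsilon>: "\<epsilon> > 0" "\<epsilon> < d" "\<epsilon> < r"
    using d(1) \<open>r > 0\<close> by (auto simp: \<epsilon>_def)
  \<comment> \<open>The \<open>2 * l\<close> adds the two componentwise bounds and the summand 2
    serves the far case. It also keeps the factor positive, so an infinite distance gives an
    infinite right-hand side even for \<open>l = 0\<close>.\<close>
  have "ereal (norm (x - xbar)) + set_distance \<mu> ?L
      \<le> ereal (2 * l + 2) * (ereal (norm (Psi f \<Phi> x \<mu>)) + set_distance (\<Phi> x) (?N \<mu>))"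
    if "(x, \<mu>) \<in> cball (xbar, \<mu>bar) \<epsilon>" for x \<mu>
  proof -
    have dist: "dist (x, \<mu>) (xbar, \<mu>bar) \<le> \<epsilon>"
      using that by (simp add: dist_commute)
    have L: "set_distance \<mu> ?L = ereal (infdist \<mu> ?L)"
      using solution by (auto simp: set_distance_def)
    show ?thesis
    proof (cases "?N \<mu> = {}")
      case True
      then show ?thesis
        using \<open>l \<ge> 0\<close> by (simp add: set_distance_def)
    next
      case False
      let ?d = "infdist (\<Phi> x) (?N \<mu>)"
      have "norm (x - xbar) + infdist \<mu> ?L \<le> (2 * l + 2) * (norm (Psi f \<Phi> x \<mu>) + ?d)"
      proof (cases "?d < r")
        case True
        obtain z where z: "z \<in> ?N \<mu>" "?d = dist (\<Phi> x) z"
          using infdist_attains_inf[OF closed_normal_cone_inverse False] by blast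
        have "norm (x - xbar) \<le> l * (norm (Psi f \<Phi> x \<mu>) + norm (z - \<Phi> x))
          \<and> infdist \<mu> ?L \<le> l * (norm (Psi f \<Phi> x \<mu>) + norm (z - \<Phi> x))"
          using dist \<epsilon> d(2)[of x \<mu>] z True
          by (intro calm) (auto simp: dist_norm norm_minus_commute normal_cone_inverse_def)
        then have "norm (x - xbar) + infdist \<mu> ?L \<le> (2 * l) * (norm (Psi f \<Phi> x \<mu>) + ?d)"
          by (simp add: z(2) dist_norm norm_minus_commute)
        also have "\<dots> \<le> (2 * l + 2) * (norm (Psi f \<Phi> x \<mu>) + ?d)"
          by (intro mult_right_mono) (auto simp: infdist_nonneg)
        finally show ?thesis .
      next
        case False
        have "infdist \<mu> ?L \<le> dist \<mu> \<mu>bar"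
          using solution by (rule infdist_le)
        also have "\<dots> \<le> \<epsilon>"
          using dist dist_snd_le[of "(x, \<mu>)" "(xbar, \<mu>bar)"] by simp
        finally have "infdist \<mu> ?L \<le> r"
          using \<epsilon> by simp
        moreover have "norm (x - xbar) \<le> r"
          using dist \<epsilon> dist_fst_le[of "(x, \<mu>)" "(xbar, \<mu>bar)"] by (simp add: dist_norm)
        ultimately have "norm (x - xbar) + infdist \<mu> ?L \<le> 2 * (norm (Psi f \<Phi> x \<mu>) + ?d)"
          using False norm_ge_zero[of "Psi f \<Phi> x \<mu>"] by argo
        also have "\<dots> \<le> (2 * l + 2) * (norm (Psi f \<Phi> x \<mu>) + ?d)"
          using \<open>l \<ge> 0\<close> by (intro mult_right_mono) (auto simp: infdist_nonneg)
        finally show ?thesis .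
      qed
      then show ?thesis
        using False by (simp add: L) (simp add: set_distance_def)
    qed
  qed
  then show ?thesis
    unfolding error_bound_def using \<epsilon>(1) \<open>l \<ge> 0\<close>
    by (intro exI[of _ \<epsilon>] exI[of _ "2 * l + 2"] conjI) auto
qed

section \<open>Semi-isolated calmness forces noncriticality\<close>

lemma semi_isolated_calm_imp_noncritical:
  assumes "semi_isolated_calm f \<Phi> \<Theta> xbar \<mu>bar"
  shows "noncritical f \<Phi> \<Theta> xbar \<mu>bar"
proof -
  have "\<xi> = 0" if \<eta>: "\<eta> \<in> graphical_derivative (normal_cone \<Theta>) (\<Phi> xbar) \<mu>bar (\<Phi>' xbar \<xi>)"
    and eq: "nabla (\<lambda>u. Psi f \<Phi> u \<mu>bar) xbar \<xi> + adj (\<Phi>' xbar) \<eta> = 0" for \<xi> \<eta>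
  proof -
    obtain t us where t: "t \<longlonglongrightarrow> 0" "\<And>k. 0 < t k" and us: "us \<longlonglongrightarrow> (\<Phi>' xbar \<xi>, \<eta>)"
      and mem: "\<And>k. (\<Phi> xbar, \<mu>bar) + t k *\<^sub>R us k \<in> gph (normal_cone \<Theta>)"
      using \<eta> unfolding graphical_derivative_def tangent_cone_def by blast
    \<comment> \<open>The points move along the fixed direction \<open>\<xi>\<close>;
      \<open>w k\<close> is the gap between \<open>\<Phi> (x k)\<close> and the base point of the
      graph element that carries the multiplier \<open>\<mu> k\<close>.\<close>
    define x where "x k = xbar + t k *\<^sub>R \<xi>" for k
    define \<mu> where "\<mu> k = \<mu>bar + t k *\<^sub>R snd (us k)" for k
    define w where "w k = \<Phi> xbar + t k *\<^sub>R fst (us k) - \<Phi> (x k)" for k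
    have us': "(\<lambda>k. fst (us k)) \<longlonglongrightarrow> \<Phi>' xbar \<xi>" "(\<lambda>k. snd (us k)) \<longlonglongrightarrow> \<eta>"
      using tendsto_fst[OF us] tendsto_snd[OF us] by auto
    have x: "x \<longlonglongrightarrow> xbar" and \<mu>: "\<mu> \<longlonglongrightarrow> \<mu>bar"
      unfolding x_def \<mu>_def by (rule tendsto_eq_intros t us' | simp)+
    have w: "(\<lambda>k. w k /\<^sub>R t k) \<longlonglongrightarrow> 0"
    proof -
      have "(\<lambda>k. fst (us k) - (\<Phi> (xbar + t k *\<^sub>R \<xi>) - \<Phi> xbar) /\<^sub>R t k) \<longlonglongrightarrow> \<Phi>' xbar \<xi> - \<Phi>' xbar \<xi>"
        by (intro tendsto_diff us' has_derivative_sequence_quotient[OF \<Phi>_deriv t] tendsto_const)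
      moreover have "w k /\<^sub>R t k = fst (us k) - (\<Phi> (xbar + t k *\<^sub>R \<xi>) - \<Phi> xbar) /\<^sub>R t k" for k
        using t(2)[of k] by (simp add: w_def x_def scaleR_diff_right scaleR_add_right)
      ultimately show ?thesis by simp
    qed
    \<comment> \<open>As \<open>Psi\<close> vanishes at \<open>(xbar, \<mu>bar)\<close>, its value
      at \<open>(xbar, \<mu> k)\<close> is purely the linear term in \<open>snd (us k)\<close>, and
      the limit is the left-hand side of \<open>eq\<close>.\<close>
    have P: "(\<lambda>k. Psi f \<Phi> (x k) (\<mu> k) /\<^sub>R t k) \<longlonglongrightarrow> 0"
    proof -
      have "(\<lambda>k. (Psi f \<Phi> (x k) (\<mu> k) - Psi f \<Phi> xbar (\<mu> k)) /\<^sub>R t k + adj (\<Phi>' xbar) (snd (us k)))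
        \<longlonglongrightarrow> nabla (\<lambda>u. Psi f \<Phi> u \<mu>bar) xbar \<xi> + adj (\<Phi>' xbar) \<eta>"
        unfolding x_def by (intro tendsto_add adj.tendsto us' tendsto_const Psi_quotient[OF t _ \<mu>])
      moreover have "Psi f \<Phi> xbar (\<mu> k) = t k *\<^sub>R adj (\<Phi>' xbar) (snd (us k))" for k
        using Psi_diff_multiplier[of xbar "\<mu> k" \<mu>bar] solution
        by (simp add: multipliers_def \<mu>_def adj.scaleR_right)
      ultimately show ?thesis
        using t(2) by (simp add: eq scaleR_diff_right less_imp_neq[symmetric])
    qed
    obtain l r where "l \<ge> 0" "r > 0" and
      calm: "\<And>x \<mu> w. \<lbrakk>dist (x, \<mu>) (xbar, \<mu>bar) < r; norm (Psi f \<Phi> x \<mu>) < r; norm w < r;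
         \<mu> \<in> normal_cone \<Theta> (\<Phi> x + w)\<rbrakk>
        \<Longrightarrow> norm (x - xbar) \<le> l * (norm (Psi f \<Phi> x \<mu>) + norm w)"
      using semi_isolated_calmE[OF assms] by metis
    have w0: "w \<longlonglongrightarrow> 0" and P0: "(\<lambda>k. Psi f \<Phi> (x k) (\<mu> k)) \<longlonglongrightarrow> 0"
      using tendsto_scaleR[OF t(1) w] tendsto_scaleR[OF t(1) P] t(2) by (auto simp: less_imp_neq[symmetric])
    \<comment> \<open>Dividing the calmness estimate by \<open>t k\<close> leaves the constant
      \<open>norm \<xi>\<close> on the left and a null sequence on the right.\<close>
    have "\<forall>\<^sub>F k in sequentially. norm \<xi> \<le> l * (norm (Psi f \<Phi> (x k) (\<mu> k) /\<^sub>R t k) + norm (w k /\<^sub>R t k))"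
      using tendstoD[OF tendsto_Pair[OF x \<mu>] \<open>r > 0\<close>] order_tendstoD(2)[OF tendsto_norm_zero[OF w0] \<open>r > 0\<close>]
        order_tendstoD(2)[OF tendsto_norm_zero[OF P0] \<open>r > 0\<close>]
    proof eventually_elim
      case (elim k)
      have "\<mu> k \<in> normal_cone \<Theta> (\<Phi> (x k) + w k)"
        using mem[of k] by (cases "us k") (simp add: gph_def \<mu>_def w_def)
      then have "norm (x k - xbar) \<le> l * (norm (Psi f \<Phi> (x k) (\<mu> k)) + norm (w k))"
        using elim by (intro calm)
      then have "(t k * norm \<xi>) / t k \<le> (l * (norm (Psi f \<Phi> (x k) (\<mu> k)) + norm (w k))) / t k"
        using t(2)[of k] by (intro divide_right_mono) (auto simp: x_def)
      then show ?case
        using t(2)[of k] by (simp add: divide_inverse algebra_simps)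
    qed
    moreover have "(\<lambda>k. l * (norm (Psi f \<Phi> (x k) (\<mu> k) /\<^sub>R t k) + norm (w k /\<^sub>R t k))) \<longlonglongrightarrow> l * (0 + 0)"
      by (intro tendsto_mult tendsto_const tendsto_add tendsto_norm_zero w P)
    ultimately have "norm \<xi> \<le> l * (0 + 0)"
      by (intro tendsto_lowerbound[OF _ _ sequentially_bot])
    then show "\<xi> = 0" by simp
  qed
  then show ?thesis
    unfolding noncritical_def using solution by (auto simp: nabla_\<Phi> simp flip: adj_def)
qed

end

section \<open>Submersions and cone reductions\<close>

lemma surj_blinfun_right_inverse:
  fixes A :: "'a::euclidean_space \<Rightarrow>\<^sub>L 'b::euclidean_space"
  assumes "surj (blinfun_apply A)"
  obtains B where "\<And>e. A (blinfun_apply B e) = e"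
proof -
  have "linear (blinfun_apply A)"
    by (simp add: blinfun.bounded_linear_right bounded_linear.linear)
  then obtain g where g: "linear g" "blinfun_apply A \<circ> g = id"
    using linear_surjective_right_inverse assms by blast
  then have "bounded_linear g"
    by (simp add: linear_conv_bounded_linear)
  with g(2) show thesis
    by (intro that[of "Blinfun g"]) (metis bounded_linear_Blinfun_apply comp_apply id_apply)
qed

text \<open>With \<open>A = h' z\<close> and a right inverse \<open>B\<close> of \<open>A\<close>, the map \<open>y \<mapsto> y - B (A y) + B (h y)\<close> is a local
  diffeomorphism at \<open>z\<close> that \<open>A\<close> carries to \<open>h\<close>.\<close>

lemma submersion_lift_sequence:
  fixes h :: "'a::euclidean_space \<Rightarrow> 'b::euclidean_space" and h' :: "'a \<Rightarrow> 'a \<Rightarrow>\<^sub>L 'b"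
  assumes h: "\<And>x. (h has_derivative blinfun_apply (h' x)) (at x)" and h': "continuous_on UNIV h'"
    and surj: "surj (blinfun_apply (h' z))"
    and t: "t \<longlonglongrightarrow> 0" "\<And>k. 0 < t k" and d: "d \<longlonglongrightarrow> h' z w"
  obtains ws where "ws \<longlonglongrightarrow> w" "\<forall>\<^sub>F k in sequentially. h (z + t k *\<^sub>R ws k) = h z + t k *\<^sub>R d k"
proof -
  let ?A = "h' z"
  obtain B where B: "\<And>e. ?A (blinfun_apply B e) = e"
    using surj_blinfun_right_inverse[OF surj] by blast
  define F where "F y = y - B (?A y) + B (h y)" for y
  define F' where "F' y = id_blinfun - (B o\<^sub>L ?A) + (B o\<^sub>L h' y)" for y
  have AF: "?A (F y) = h y" for y
    by (simp add: F_def blinfun.bilinear_simps B)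
  have F'z: "F' z = id_blinfun"
    by (simp add: F'_def)
  have F_deriv: "(F has_derivative blinfun_apply (F' y)) (at y)" for y
    unfolding F_def F'_def
    by (rule has_derivative_eq_rhs, (rule derivative_intros h
          bounded_linear.has_derivative[OF blinfun.bounded_linear_right])+)
      (auto simp: blinfun.bilinear_simps)
  have F'_cont: "continuous_on UNIV F'"
    unfolding F'_def by (intro continuous_intros h')
  have "id_blinfun o\<^sub>L F' z = id_blinfun"
    by (rule blinfun_eqI) (simp add: F'z)
  then have "\<exists>U V g g'. z \<in> U \<and> open V \<and> F z \<in> V \<and> homeomorphism U V F g
      \<and> (\<forall>y\<in>V. (g has_derivative g' y) (at y) \<and> g' y = inv (blinfun_apply (F' (g y))))"
    by (rule inverse_function_theorem[OF open_UNIV F_deriv F'_cont UNIV_I]) blast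
  then obtain U V g g' where UV: "z \<in> U" "open V" "F z \<in> V" "homeomorphism U V F g"
    and g: "\<And>y. y \<in> V \<Longrightarrow> (g has_derivative (g' y)) (at y)"
    and g': "\<And>y. y \<in> V \<Longrightarrow> g' y = inv (blinfun_apply (F' (g y)))"
    by blast
  have gF: "g (F z) = z"
    using UV by (simp add: homeomorphism_def)
  have "g' (F z) = id"
    using g'[OF UV(3)] by (simp add: gF F'z id_blinfun.rep_eq flip: id_def)
  then have g_id: "(g has_derivative id) (at (F z))"
    using g[OF UV(3)] by simp
  \<comment> \<open>A correction of \<open>w\<close> through the right inverse:
    \<open>?A (e k) = d k\<close>, while \<open>e\<close> still converges to
    \<open>w\<close>.\<close>
  define e where "e k = w + B (d k - ?A w)" for k
  have "e \<longlonglongrightarrow> w + B (?A w - ?A w)"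
    unfolding e_def by (intro tendsto_intros d)
  then have e: "e \<longlonglongrightarrow> w"
    by (simp add: blinfun.zero_right)
  \<comment> \<open>The difference quotient of the local inverse \<open>g\<close>, whose derivative
    at \<open>F z\<close> is the identity; hence the limit is \<open>w\<close>.\<close>
  define ws where "ws k = (g (F z + t k *\<^sub>R e k) - z) /\<^sub>R t k" for k
  have "ws \<longlonglongrightarrow> w"
    using has_derivative_sequence_quotient[OF g_id t e] by (simp add: ws_def[abs_def] gF)
  moreover have "(\<lambda>k. F z + t k *\<^sub>R e k) \<longlonglongrightarrow> F z + 0 *\<^sub>R w"
    by (intro tendsto_intros t e)
  then have "\<forall>\<^sub>F k in sequentially. F z + t k *\<^sub>R e k \<in> V"
    using UV(2,3) topological_tendstoD by fastforce
  then have "\<forall>\<^sub>F k in sequentially. h (z + t k *\<^sub>R ws k) = h z + t k *\<^sub>R d k"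
  proof eventually_elim
    case (elim k)
    have "F (z + t k *\<^sub>R ws k) = F z + t k *\<^sub>R e k"
      using elim UV(4) t(2)[of k] by (simp add: ws_def homeomorphism_def)
    then have "?A (F (z + t k *\<^sub>R ws k)) = ?A (F z + t k *\<^sub>R e k)"
      by simp
    then show ?case
      unfolding blinfun.add_right AF by (simp add: e_def blinfun.bilinear_simps B)
  qed
  ultimately show thesis
    using that by blast
qed

text \<open>With a right inverse \<open>B\<close> of \<open>A\<close>, the operator
  \<open>T o B\<close> is the identity plus a perturbation of norm below 1/2. It is injective, hence
  surjective in finite dimension, and its adjoint is bounded below, which bounds
  \<open>adj T\<close> below.\<close>

lemma eventually_surj_blinfun:
  fixes A :: "'a::euclidean_space \<Rightarrow>\<^sub>L 'b::euclidean_space"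
  assumes "surj (blinfun_apply A)"
  obtains K where "K > 0"
    "\<forall>\<^sub>F T in nhds A. surj (blinfun_apply T) \<and> (\<forall>\<rho>. norm \<rho> \<le> K * norm (adj T \<rho>))"
proof -
  obtain B where B: "\<And>e. A (blinfun_apply B e) = e"
    using surj_blinfun_right_inverse[OF assms] by blast
  \<comment> \<open>The estimate needs \<open>2 * norm B\<close>; the added 1 gives positivity
    without asking whether \<open>B\<close> is zero.\<close>
  define K where "K = 2 * norm B + 1"
  have "K > 0"
    by (simp add: K_def add_nonneg_pos)
  have "((\<lambda>T. (T - A) o\<^sub>L B) \<longlongrightarrow> (A - A) o\<^sub>L B) (nhds A)"
    by (intro tendsto_intros filterlim_ident)
  then have "((\<lambda>T. norm ((T - A) o\<^sub>L B)) \<longlongrightarrow> 0) (nhds A)"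
    by (intro tendsto_norm_zero) simp
  then have "\<forall>\<^sub>F T in nhds A. norm ((T - A) o\<^sub>L B) < 1/2"
    by (rule order_tendstoD) simp
  then have "\<forall>\<^sub>F T in nhds A. surj (blinfun_apply T) \<and> (\<forall>\<rho>. norm \<rho> \<le> K * norm (adj T \<rho>))"
  proof eventually_elim
    case (elim T)
    let ?R = "(T - A) o\<^sub>L B"
    have TB: "T (B e) = e + ?R e" for e
      by (simp add: blinfun.bilinear_simps B)
    have "inj (blinfun_apply (T o\<^sub>L B))"
    proof (rule injI)
      fix x y assume "(T o\<^sub>L B) x = (T o\<^sub>L B) y"
      then have "?R (x - y) = y - x"
        using TB[of x] TB[of y] by (simp add: blinfun.diff_right algebra_simps)
      then have "norm (x - y) \<le> norm ?R * norm (x - y)"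
        using norm_blinfun[of ?R "x - y"] by (simp add: norm_minus_commute)
      also have "\<dots> \<le> 1/2 * norm (x - y)"
        using elim by (intro mult_right_mono) auto
      finally show "x = y" by simp
    qed
    then have "surj (blinfun_apply (T o\<^sub>L B))"
      by (intro linear_inj_imp_surj) (simp_all add: blinfun.bounded_linear_right bounded_linear.linear)
    then have "surj (blinfun_apply T)"
      unfolding surj_def blinfun_apply_blinfun_compose by blast
    moreover have "norm \<rho> \<le> K * norm (adj T \<rho>)" for \<rho>
    proof -
      have "adj B (adj T \<rho>) = \<rho> + adj ?R \<rho>"
        by (rule adj_eqI) (simp add: inner_adj inner_add_right TB inner_add_left)
      then have "norm \<rho> \<le> norm (adj B (adj T \<rho>)) + norm (adj ?R \<rho>)"
        by (metis add_diff_cancel_right' norm_triangle_ineq4)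
      also have "\<dots> \<le> norm B * norm (adj T \<rho>) + 1/2 * norm \<rho>"
      proof (intro add_mono norm_adj_le)
        have "norm (adj ?R \<rho>) \<le> norm ?R * norm \<rho>"
          by (rule norm_adj_le)
        also have "\<dots> \<le> 1/2 * norm \<rho>"
          using elim by (intro mult_right_mono) auto
        finally show "norm (adj ?R \<rho>) \<le> 1/2 * norm \<rho>" .
      qed
      finally have "norm \<rho> \<le> 2 * norm B * norm (adj T \<rho>)"
        by simp
      also have "\<dots> \<le> K * norm (adj T \<rho>)"
        by (intro mult_right_mono) (auto simp: K_def)
      finally show ?thesis .
    qed
    ultimately show ?case by blast
  qed
  with \<open>K > 0\<close> show thesis
    by (rule that)
qed

text \<open>For a right inverse \<open>B\<close>, every \<open>w - B (T w)\<close> lies in the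
  kernel, so \<open>v\<close> is the image under \<open>adj T\<close> of
  \<open>adj B v\<close>.\<close>

lemma range_adj_if_annihilates_kernel:
  assumes "surj (blinfun_apply T)" "\<And>w. T w = 0 \<Longrightarrow> v \<bullet> w = 0"
  obtains \<rho> where "v = adj T \<rho>"
proof -
  obtain B where B: "\<And>e. T (blinfun_apply B e) = e"
    using surj_blinfun_right_inverse[OF assms(1)] by blast
  have "v \<bullet> (w - B (T w)) = 0" for w
    by (rule assms(2)) (simp add: blinfun.diff_right B)
  then have "B (T w) \<bullet> v = w \<bullet> v" for w
    by (metis eq_iff_diff_eq_0 inner_commute inner_diff_right)
  then have "adj T (adj B v) = v"
    by (intro adj_eqI) (simp add: inner_adj)
  with that show thesis by metis
qed

section \<open>Tangent sequences and projection onto a convex cone\<close>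

lemma tangent_cone_eventuallyI:
  assumes "t \<longlonglongrightarrow> 0" "\<And>k. 0 < t k" "ws \<longlonglongrightarrow> w" "\<forall>\<^sub>F k in sequentially. x + t k *\<^sub>R ws k \<in> A"
  shows "w \<in> tangent_cone A x"
proof -
  obtain n where "\<And>k. k \<ge> n \<Longrightarrow> x + t k *\<^sub>R ws k \<in> A"
    using assms(4) by (auto simp: eventually_sequentially)
  then show ?thesis
    unfolding tangent_cone_def using assms(1-3)
    by (auto intro!: exI[of _ "\<lambda>k. t (k + n)"] exI[of _ "\<lambda>k. ws (k + n)"] LIMSEQ_ignore_initial_segment)
qed

lemma regular_normal_cone_subset: "x \<in> A \<Longrightarrow> regular_normal_cone A x \<subseteq> normal_cone A x"
  unfolding normal_cone_def by (auto intro!: exI[of _ "\<lambda>_. x"] exI[of _ "\<lambda>_. _"])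

text \<open>Otherwise some subsequence stays away from \<open>l0\<close>, and boundedness gives it a
  convergent subsequence with a different limit.\<close>

lemma convergent_if_subsequence_limits_eq:
  fixes c :: "nat \<Rightarrow> 'a::heine_borel"
  assumes "bounded (range c)"
    and lim: "\<And>r l. strict_mono r \<Longrightarrow> (c \<circ> r) \<longlonglongrightarrow> l \<Longrightarrow> l = l0"
  shows "c \<longlonglongrightarrow> l0"
proof (rule ccontr)
  assume "\<not> c \<longlonglongrightarrow> l0"
  then obtain e where e: "e > 0" "\<not> (\<forall>\<^sub>F k in sequentially. dist (c k) l0 < e)"
    unfolding tendsto_iff by blast
  from not_eventually_sequentiallyD[OF e(2)]
  obtain r :: "nat \<Rightarrow> nat" where r: "strict_mono r" "\<And>n. \<not> dist (c (r n)) l0 < e"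
    by blast
  have "bounded (range (c \<circ> r))"
    using assms(1) by (rule bounded_subset) auto
  then obtain l s where s: "strict_mono s" "(c \<circ> r \<circ> s) \<longlonglongrightarrow> l"
    using bounded_imp_convergent_subsequence by metis
  have "l = l0"
    using lim[of "r \<circ> s" l] s r(1) by (simp add: strict_mono_o o_assoc)
  then have "\<forall>\<^sub>F k in sequentially. dist ((c \<circ> r \<circ> s) k) l0 < e"
    using tendstoD s(2) e(1) by metis
  then show False
    using r(2) by simp
qed

text \<open>The pairs are \<open>c k = P (q + \<alpha> + \<rho> / t k)\<close> and \<open>a k = q + \<alpha> - c k\<close> with \<open>P\<close> the projection onto \<open>C\<close>:
  as \<open>t k \<rightarrow> 0\<close> the term \<open>\<rho> / t k\<close> forces \<open>c k\<close> towards the critical cone, on which \<open>q + \<alpha>\<close> projects to \<open>q\<close>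
  by Moreau's decomposition.\<close>

lemma complementary_tangent_sequences:
  fixes C :: "'e::euclidean_space set"
  assumes C: "closed C" "convex C" "cone C"
    and \<rho>: "\<rho> \<in> polar C" and q: "q \<in> C" "\<rho> \<bullet> q = 0"
    and \<alpha>: "\<alpha> \<in> polar (C \<inter> {\<rho>}\<^sup>\<bottom>)" "\<alpha> \<bullet> q = 0"
    and t: "t \<longlonglongrightarrow> 0" "\<And>k. (0::real) < t k"
  obtains c a where "c \<longlonglongrightarrow> q" "a \<longlonglongrightarrow> \<alpha>" "\<And>k. c k \<in> C"
    "\<And>k. \<rho> + t k *\<^sub>R a k \<in> polar C" "\<And>k. (\<rho> + t k *\<^sub>R a k) \<bullet> c k = 0"
proof -
  define d where "d k = q + \<alpha> + \<rho> /\<^sub>R t k" for k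
  define c where "c k = closest_point C (d k)" for k
  define a where "a k = q + \<alpha> - c k" for k
  have cone: "s *\<^sub>R x \<in> C" if "x \<in> C" "s \<ge> 0" for x s
    using C(3) that by (simp add: cone_def)
  have c: "c k \<in> C" for k
    unfolding c_def using C q by (intro closest_point_in_set) auto
  have dot: "(d k - c k) \<bullet> (x - c k) \<le> 0" if "x \<in> C" for k x
    unfolding c_def using C that by (intro closest_point_dot)
  \<comment> \<open>The projection inequality is tested at twice the projection and at zero, both in
    the cone.\<close>
  have orth: "(d k - c k) \<bullet> c k = 0" for k
    using dot[OF cone[OF c, of 2 k], of k] dot[OF cone[OF c, of 0 k], of k] by (simp add: scaleR_2)
  have pol: "(d k - c k) \<bullet> x \<le> 0" if "x \<in> C" for k x
    using dot[OF that, of k] orth[of k] by (simp add: inner_diff_right)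
  \<comment> \<open>The perturbed multiplier is the projection residual times \<open>t k\<close>, so
    it inherits polarity and complementarity from the residual.\<close>
  have res: "\<rho> + t k *\<^sub>R a k = t k *\<^sub>R (d k - c k)" for k
    using t(2)[of k] by (simp add: a_def d_def algebra_simps)
  have \<rho>c: "\<rho> \<bullet> c k \<le> 0" for k
    using \<rho> c by (simp add: polar_def)
  \<comment> \<open>The projection inequality tested at \<open>q\<close>, where
    \<open>\<alpha>\<close> and \<open>\<rho>\<close> both vanish.\<close>
  have key: "(norm (q - c k))\<^sup>2 \<le> \<alpha> \<bullet> c k + \<rho> \<bullet> c k / t k" for k
  proof -
    have "(d k - c k) \<bullet> (q - c k) = (norm (q - c k))\<^sup>2 - \<alpha> \<bullet> c k - \<rho> \<bullet> c k / t k"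
      by (simp add: d_def power2_norm_eq_inner inner_simps \<alpha>(2) q(2) divide_inverse algebra_simps)
    then show ?thesis
      using dot[OF q(1), of k] by simp
  qed
  have \<alpha>c: "(norm (q - c k))\<^sup>2 \<le> \<alpha> \<bullet> c k" for k
    using key[of k] divide_nonpos_pos[OF \<rho>c t(2), of k k] by simp
  have bound: "norm (q - c k) \<le> norm \<alpha>" for k
  proof -
    have "\<alpha> \<bullet> c k = \<alpha> \<bullet> (c k - q)"
      by (simp add: inner_diff_right \<alpha>(2))
    also have "\<dots> \<le> norm \<alpha> * norm (q - c k)"
      using norm_cauchy_schwarz[of \<alpha> "c k - q"] by (simp add: norm_minus_commute)
    finally have "norm (q - c k) * norm (q - c k) \<le> norm \<alpha> * norm (q - c k)"
      using \<alpha>c[of k] by (simp add: power2_eq_square)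
    then show ?thesis
      by (cases "norm (q - c k) = 0") (auto simp: mult_le_cancel_right)
  qed
  have "norm (c k) \<le> norm q + norm \<alpha>" for k
    using bound[of k] norm_triangle_ineq4[of q "q - c k"] by simp
  then have bdd: "bounded (range c)"
    by (auto intro!: boundedI)
  have clim: "c \<longlonglongrightarrow> q"
  proof (rule convergent_if_subsequence_limits_eq[OF bdd])
    fix r l assume r: "strict_mono r" and l: "(c \<circ> r) \<longlonglongrightarrow> l"
    have lC: "l \<in> C"
      using closed_sequentially[OF C(1) _ l] c by simp
    have tr: "(\<lambda>k. t (r k)) \<longlonglongrightarrow> 0"
      using LIMSEQ_subseq_LIMSEQ[OF t(1) r] by (simp add: o_def)
    have l': "(\<lambda>k. c (r k)) \<longlonglongrightarrow> l"
      using l by (simp add: o_def)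
    \<comment> \<open>Multiplying \<open>key\<close> by \<open>t k\<close> and dropping the square
      bounds \<open>\<rho> \<bullet> c k\<close> below by a null sequence. So the limit
      \<open>l\<close> is orthogonal to \<open>\<rho>\<close>, and polarity of
      \<open>\<alpha>\<close> then collapses the distance to \<open>q\<close>.\<close>
    have le: "- (t k * (\<alpha> \<bullet> c k)) \<le> \<rho> \<bullet> c k" for k
    proof -
      have "0 \<le> t k * (\<alpha> \<bullet> c k + \<rho> \<bullet> c k / t k)"
        using order_trans[OF zero_le_power2 key] t(2)[of k] by (simp add: less_imp_le)
      then show ?thesis
        using t(2)[of k] by (simp add: distrib_left)
    qed
    have "- (0 * (\<alpha> \<bullet> l)) \<le> \<rho> \<bullet> l"
      by (rule LIMSEQ_le[of "\<lambda>k. - (t (r k) * (\<alpha> \<bullet> c (r k)))" _ "\<lambda>k. \<rho> \<bullet> c (r k)"])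
        (intro tendsto_intros tr l', intro tendsto_intros l', use le in blast)
    moreover have "\<rho> \<bullet> l \<le> 0"
      using \<rho> lC by (simp add: polar_def)
    ultimately have "l \<in> C \<inter> {\<rho>}\<^sup>\<bottom>"
      using lC by (simp add: orthogonal_comp_def orthogonal_def)
    then have "\<alpha> \<bullet> l \<le> 0"
      using \<alpha>(1) by (simp add: polar_def)
    moreover have "(norm (q - l))\<^sup>2 \<le> \<alpha> \<bullet> l"
      by (rule LIMSEQ_le[of "\<lambda>k. (norm (q - c (r k)))\<^sup>2" _ "\<lambda>k. \<alpha> \<bullet> c (r k)"])
        (intro tendsto_intros l', intro tendsto_intros l', use \<alpha>c in blast)
    ultimately have "(norm (q - l))\<^sup>2 \<le> 0"
      by linarith
    then show "l = q" by simp
  qed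
  have "a \<longlonglongrightarrow> q + \<alpha> - q"
    unfolding a_def by (intro tendsto_intros clim)
  then have "a \<longlonglongrightarrow> \<alpha>" by simp
  moreover have "\<rho> + t k *\<^sub>R a k \<in> polar C" for k
    unfolding res polar_def using pol[of _ k] t(2)[of k] by (auto simp: mult_nonneg_nonpos)
  moreover have "(\<rho> + t k *\<^sub>R a k) \<bullet> c k = 0" for k
    unfolding res by (simp add: orth)
  ultimately show thesis
    using that clim c by blast
qed

section \<open>Tangents, normals and graphical derivatives under a cone reduction\<close>

lemma inverse_Suc_sequence:
  "(\<lambda>k. inverse (real (Suc k))) \<longlonglongrightarrow> 0" "0 < inverse (real (Suc k))" "inverse (real (Suc k)) \<le> 1"
  by (auto intro: LIMSEQ_inverse_real_of_nat simp: inverse_le_1_iff simp del: of_nat_Suc)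

text \<open>The reduction in working form: an open neighbourhood \<open>N\<close>, and derivatives
  given as operator-valued maps so that \<open>adj\<close> and difference quotients apply to
  them.\<close>

locale cone_reduction =
  fixes \<Theta> N :: "'y::euclidean_space set" and C :: "'e::euclidean_space set"
    and h :: "'y \<Rightarrow> 'e" and h' :: "'y \<Rightarrow> 'y \<Rightarrow>\<^sub>L 'e" and h'' :: "'y \<Rightarrow> 'y \<Rightarrow>\<^sub>L 'e" and zbar :: 'y
  assumes closed_C: "closed C" and convex_C: "convex C" and cone_C: "cone C"
    and open_N: "open N" and zbar_N: "zbar \<in> N"
    and \<Theta>_iff: "\<And>y. y \<in> N \<Longrightarrow> y \<in> \<Theta> \<longleftrightarrow> h y \<in> C"
    and zbar_\<Theta>: "zbar \<in> \<Theta>" and h_zbar: "h zbar = 0"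
    and h_deriv: "\<And>y. (h has_derivative blinfun_apply (h' y)) (at y)"
    and h'_cont: "continuous_on UNIV h'"
    and h'_deriv: "(h' has_derivative h'') (at zbar)"
    and h'_surj: "surj (blinfun_apply (h' zbar))"
begin

lemma zero_mem_C: "0 \<in> C"
  using \<Theta>_iff[OF zbar_N] zbar_\<Theta> h_zbar by simp

lemma scaleR_mem_C: "x \<in> C \<Longrightarrow> s \<ge> 0 \<Longrightarrow> s *\<^sub>R x \<in> C"
  using cone_C by (simp add: cone_def)

lemma add_mem_C: "x \<in> C \<Longrightarrow> y \<in> C \<Longrightarrow> x + y \<in> C"
  using cone_C convex_C convex_cone by blast

lemma scaleR_mem_C_iff: "s > 0 \<Longrightarrow> s *\<^sub>R x \<in> C \<longleftrightarrow> x \<in> C"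
  using scaleR_mem_C[of "s *\<^sub>R x" "inverse s"] scaleR_mem_C[of x s] by auto

lemma tendsto_h': "(x \<longlongrightarrow> x0) F \<Longrightarrow> ((\<lambda>k. h' (x k)) \<longlongrightarrow> h' x0) F"
  using h'_cont by (simp add: continuous_on_eq_continuous_at isCont_tendsto_compose)

lemma tendsto_add_scaleR:
  assumes "t \<longlonglongrightarrow> (0::real)" "w \<longlonglongrightarrow> w0"
  shows "(\<lambda>k. z + t k *\<^sub>R w k) \<longlonglongrightarrow> (z :: 'y)"
  using tendsto_add[OF tendsto_const[of z] tendsto_scaleR[OF assms]] by simp

text \<open>The segment in \<open>C\<close> that starts at \<open>h z\<close> lifts through the
  submersion to a sequence of points of \<open>\<Theta>\<close> with limiting direction
  \<open>w\<close>.\<close>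

lemma mem_tangent_coneI:
  assumes z: "z \<in> N" and surj: "surj (blinfun_apply (h' z))"
    and C: "\<And>s. 0 < s \<Longrightarrow> s \<le> 1 \<Longrightarrow> h z + s *\<^sub>R h' z w \<in> C"
  shows "w \<in> tangent_cone \<Theta> z"
proof -
  define t where "t k = inverse (real (Suc k))" for k
  have t: "t \<longlonglongrightarrow> 0" "\<And>k. 0 < t k" "\<And>k. t k \<le> 1"
    unfolding t_def by (rule inverse_Suc_sequence)+
  obtain ws where ws: "ws \<longlonglongrightarrow> w" "\<forall>\<^sub>F k in sequentially. h (z + t k *\<^sub>R ws k) = h z + t k *\<^sub>R h' z w"
    using submersion_lift_sequence[OF h_deriv h'_cont surj t(1,2) tendsto_const] by metis
  have "\<forall>\<^sub>F k in sequentially. z + t k *\<^sub>R ws k \<in> N"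
    using topological_tendstoD[OF tendsto_add_scaleR[OF t(1) ws(1)] open_N z] .
  with ws(2) have "\<forall>\<^sub>F k in sequentially. z + t k *\<^sub>R ws k \<in> \<Theta>"
    by eventually_elim (simp add: \<Theta>_iff C t)
  with t ws(1) show ?thesis
    by (intro tangent_cone_eventuallyI)
qed

text \<open>Pushes a tangent sequence forward: the \<open>d k\<close> are the difference quotients
  of \<open>h\<close> along it.\<close>

lemma tangent_quotient:
  assumes "z \<in> N" "w \<in> tangent_cone \<Theta> z"
  obtains t d where "\<And>k. 0 < t k" "d \<longlonglongrightarrow> h' z w" "\<forall>\<^sub>F k in sequentially. h z + t k *\<^sub>R d k \<in> C"
proof -
  obtain t ws where t: "t \<longlonglongrightarrow> 0" "\<And>k. 0 < t k" and ws: "ws \<longlonglongrightarrow> w" "\<And>k. z + t k *\<^sub>R ws k \<in> \<Theta>"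
    using assms(2) unfolding tangent_cone_def by blast
  have "\<forall>\<^sub>F k in sequentially. z + t k *\<^sub>R ws k \<in> N"
    using topological_tendstoD[OF tendsto_add_scaleR[OF t(1) ws(1)] open_N assms(1)] .
  then have "\<forall>\<^sub>F k in sequentially. h z + t k *\<^sub>R ((h (z + t k *\<^sub>R ws k) - h z) /\<^sub>R t k) \<in> C"
  proof eventually_elim
    case (elim k)
    then show ?case
      using ws(2)[of k] \<Theta>_iff t(2)[of k] by simp
  qed
  with t has_derivative_sequence_quotient[OF h_deriv t ws(1)] that show thesis by blast
qed

lemma tangent_cone_zbar: "tangent_cone \<Theta> zbar = {w. h' zbar w \<in> C}"
proof (intro set_eqI iffI)
  fix w assume "w \<in> tangent_cone \<Theta> zbar"
  then obtain t d where t: "\<And>k. 0 < (t k :: real)" and d: "d \<longlonglongrightarrow> h' zbar w"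
    and "\<forall>\<^sub>F k in sequentially. h zbar + t k *\<^sub>R d k \<in> C"
    using tangent_quotient[OF zbar_N] by blast
  then have "\<forall>\<^sub>F k in sequentially. d k \<in> C"
    by (simp add: h_zbar scaleR_mem_C_iff)
  from Lim_in_closed_set[OF closed_C this _ d] show "w \<in> {w. h' zbar w \<in> C}"
    by simp
qed (auto intro!: mem_tangent_coneI zbar_N h'_surj simp: h_zbar scaleR_mem_C)

lemma critical_cone_zbar: "critical_cone \<Theta> zbar (adj (h' zbar) \<rho>) = {w. h' zbar w \<in> C \<and> \<rho> \<bullet> h' zbar w = 0}"
  by (auto simp: critical_cone_def tangent_cone_zbar orthogonal_comp_def orthogonal_def adj_inner)

text \<open>Complementarity removes the term at \<open>h z\<close>, so polarity of
  \<open>\<rho>\<close> bounds the difference quotients of \<open>h\<close>, and their limit, along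
  every tangent direction.\<close>

lemma adj_mem_regular_normal_cone:
  assumes z: "z \<in> N" and \<rho>: "\<rho> \<in> polar C" "\<rho> \<bullet> h z = 0"
  shows "adj (h' z) \<rho> \<in> regular_normal_cone \<Theta> z"
  unfolding regular_normal_cone_def polar_def
proof safe
  fix w assume "w \<in> tangent_cone \<Theta> z"
  then obtain t d where t: "\<And>k. 0 < (t k :: real)" and d: "d \<longlonglongrightarrow> h' z w"
    and ev: "\<forall>\<^sub>F k in sequentially. h z + t k *\<^sub>R d k \<in> C"
    using tangent_quotient[OF z] by blast
  from ev have "\<forall>\<^sub>F k in sequentially. \<rho> \<bullet> d k \<le> 0"
  proof eventually_elim
    case (elim k)
    then have "\<rho> \<bullet> (h z + t k *\<^sub>R d k) \<le> 0"
      using \<rho>(1) by (simp add: polar_def)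
    then show ?case
      using \<rho>(2) t[of k] by (simp add: inner_add_right mult_le_0_iff)
  qed
  moreover have "(\<lambda>k. \<rho> \<bullet> d k) \<longlonglongrightarrow> \<rho> \<bullet> h' z w"
    by (intro tendsto_intros d)
  ultimately have "\<rho> \<bullet> h' z w \<le> 0"
    using tendsto_upperbound sequentially_bot by blast
  then show "adj (h' z) \<rho> \<bullet> w \<le> 0"
    by (simp add: adj_inner)
qed

text \<open>Kernel directions of \<open>h' z\<close> are tangent with both signs, so
  \<open>v\<close> factors through the adjoint. Directions in \<open>C\<close> then give polarity,
  and the directions \<open>h z\<close> and \<open>- h z\<close> give complementarity.\<close>

lemma regular_normal_coneE:
  assumes z: "z \<in> N" "h z \<in> C" and surj: "surj (blinfun_apply (h' z))"
    and v: "v \<in> regular_normal_cone \<Theta> z"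
  obtains \<rho> where "\<rho> \<in> polar C" "\<rho> \<bullet> h z = 0" "v = adj (h' z) \<rho>"
proof -
  have le: "v \<bullet> w \<le> 0" if "\<And>s. 0 < s \<Longrightarrow> s \<le> 1 \<Longrightarrow> h z + s *\<^sub>R h' z w \<in> C" for w
    using v mem_tangent_coneI[OF z(1) surj that] by (simp add: regular_normal_cone_def polar_def)
  have "v \<bullet> w = 0" if "h' z w = 0" for w
    using le[of w] le[of "- w"] that z(2) by (simp add: blinfun.minus_right)
  then obtain \<rho> where \<rho>: "v = adj (h' z) \<rho>"
    using range_adj_if_annihilates_kernel[OF surj] by metis
  have le': "\<rho> \<bullet> e \<le> 0" if "\<And>s. 0 < s \<Longrightarrow> s \<le> 1 \<Longrightarrow> h z + s *\<^sub>R e \<in> C" for e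
  proof -
    obtain w where "e = h' z w"
      using surj by (meson surjE)
    then show ?thesis
      using le[of w] that by (simp add: \<rho> adj_inner)
  qed
  have "\<rho> \<in> polar C"
    unfolding polar_def using le' z(2) by (simp add: add_mem_C scaleR_mem_C)
  moreover have "\<rho> \<bullet> h z \<le> 0"
    by (rule le') (simp add: add_mem_C scaleR_mem_C z(2))
  \<comment> \<open>Moving by \<open>s\<close> along \<open>- h z\<close> leaves the multiple
    \<open>1 - s\<close> of \<open>h z\<close>, which is in the cone because \<open>s\<close> is at
    most 1.\<close>
  moreover have "\<rho> \<bullet> - h z \<le> 0"
  proof (rule le')
    fix s :: real assume "s \<le> 1"
    then have "(1 - s) *\<^sub>R h z \<in> C"
      by (intro scaleR_mem_C z) simp
    then show "h z + s *\<^sub>R - h z \<in> C"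
      by (simp add: scaleR_diff_left)
  qed
  then have "0 \<le> \<rho> \<bullet> h z"
    by simp
  ultimately show thesis
    using that[OF _ _ \<rho>] by force
qed

text \<open>Regular normals near \<open>zbar\<close> have coefficients \<open>\<rho>\<close> bounded
  uniformly through \<open>K\<close>. A subsequence of coefficients converges, so limiting normals
  have the same representation as regular ones.\<close>

lemma normal_cone_near_zbar:
  obtains M K where "open M" "zbar \<in> M" "K > 0"
    "\<And>z \<rho>. z \<in> M \<Longrightarrow> norm \<rho> \<le> K * norm (adj (h' z) \<rho>)"
    "\<And>z v. z \<in> M \<Longrightarrow> v \<in> normal_cone \<Theta> z
       \<longleftrightarrow> h z \<in> C \<and> (\<exists>\<rho>\<in>polar C. \<rho> \<bullet> h z = 0 \<and> v = adj (h' z) \<rho>)"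
proof -
  obtain K where K: "K > 0" "\<forall>\<^sub>F T in nhds (h' zbar). surj (blinfun_apply T) \<and> (\<forall>\<rho>. norm \<rho> \<le> K * norm (adj T \<rho>))"
    using eventually_surj_blinfun[OF h'_surj] by blast
  have "\<forall>\<^sub>F z in nhds zbar. z \<in> N \<and> surj (blinfun_apply (h' z)) \<and> (\<forall>\<rho>. norm \<rho> \<le> K * norm (adj (h' z) \<rho>))"
    using eventually_nhds_in_open[OF open_N zbar_N]
      eventually_compose_filterlim[OF K(2) tendsto_h'[OF filterlim_ident]]
    by eventually_elim simp
  then obtain M where M: "open M" "zbar \<in> M" "\<And>z. z \<in> M \<Longrightarrow> z \<in> N"
    "\<And>z. z \<in> M \<Longrightarrow> surj (blinfun_apply (h' z))" "\<And>z \<rho>. z \<in> M \<Longrightarrow> norm \<rho> \<le> K * norm (adj (h' z) \<rho>)"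
    unfolding eventually_nhds by blast
  have "v \<in> normal_cone \<Theta> z \<longleftrightarrow> h z \<in> C \<and> (\<exists>\<rho>\<in>polar C. \<rho> \<bullet> h z = 0 \<and> v = adj (h' z) \<rho>)"
    if z: "z \<in> M" for z v
  proof
    assume "h z \<in> C \<and> (\<exists>\<rho>\<in>polar C. \<rho> \<bullet> h z = 0 \<and> v = adj (h' z) \<rho>)"
    then show "v \<in> normal_cone \<Theta> z"
      using adj_mem_regular_normal_cone regular_normal_cone_subset \<Theta>_iff M(3)[OF z] by blast
  next
    assume v: "v \<in> normal_cone \<Theta> z"
    then have hz: "h z \<in> C"
      using mem_normal_cone_base \<Theta>_iff M(3)[OF z] by blast
    obtain zs vs where zs: "zs \<longlonglongrightarrow> z" "\<And>k. zs k \<in> \<Theta>" and vs: "vs \<longlonglongrightarrow> v"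
      "\<And>k. vs k \<in> regular_normal_cone \<Theta> (zs k)"
      using v unfolding normal_cone_def by blast
    obtain n where n: "\<And>k. k \<ge> n \<Longrightarrow> zs k \<in> M"
      using topological_tendstoD[OF zs(1) M(1) z] by (auto simp: eventually_sequentially)
    have "\<exists>\<rho>. \<rho> \<in> polar C \<and> \<rho> \<bullet> h (zs (k + n)) = 0 \<and> vs (k + n) = adj (h' (zs (k + n))) \<rho>" for k
    proof -
      have m: "zs (k + n) \<in> M"
        by (rule n) simp
      then have "h (zs (k + n)) \<in> C"
        using zs(2) \<Theta>_iff M(3) by blast
      then show ?thesis
        using regular_normal_coneE[OF M(3)[OF m] _ M(4)[OF m] vs(2)] by metis
    qed
    then obtain \<rho> where \<rho>: "\<And>k. \<rho> k \<in> polar C" "\<And>k. \<rho> k \<bullet> h (zs (k + n)) = 0"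
      "\<And>k. vs (k + n) = adj (h' (zs (k + n))) (\<rho> k)"
      by metis
    have vs_n: "(\<lambda>k. vs (k + n)) \<longlonglongrightarrow> v" and zs_n: "(\<lambda>k. zs (k + n)) \<longlonglongrightarrow> z"
      using vs(1) zs(1) by (auto intro: LIMSEQ_ignore_initial_segment)
    obtain b where b: "\<And>k. norm (vs (k + n)) \<le> b"
      using convergent_imp_bounded[OF vs_n] by (auto simp: bounded_iff)
    have "norm (\<rho> k) \<le> K * b" for k
    proof -
      have "norm (\<rho> k) \<le> K * norm (vs (k + n))"
        unfolding \<rho>(3) by (rule M(5)) (simp add: n)
      also have "\<dots> \<le> K * b"
        using K(1) b by simp
      finally show ?thesis .
    qed
    then have "bounded (range \<rho>)"
      by (auto intro!: boundedI)
    then obtain l r where r: "strict_mono r" and "(\<rho> \<circ> r) \<longlonglongrightarrow> l"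
      using bounded_imp_convergent_subsequence by blast
    then have l: "(\<lambda>k. \<rho> (r k)) \<longlonglongrightarrow> l"
      by (simp add: o_def)
    have zs_r: "(\<lambda>k. zs (r k + n)) \<longlonglongrightarrow> z" and vs_r: "(\<lambda>k. vs (r k + n)) \<longlonglongrightarrow> v"
      using LIMSEQ_subseq_LIMSEQ[OF zs_n r] LIMSEQ_subseq_LIMSEQ[OF vs_n r] by (auto simp: o_def)
    have "(\<lambda>k. adj (h' (zs (r k + n))) (\<rho> (r k))) \<longlonglongrightarrow> adj (h' z) l"
      by (intro adj.tendsto tendsto_h' zs_r l)
    then have "v = adj (h' z) l"
      using vs_r unfolding \<rho>(3) by (rule LIMSEQ_unique[symmetric])
    moreover have "l \<in> polar C"
      unfolding polar_def
    proof safe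
      fix x assume "x \<in> C"
      then have "\<rho> (r k) \<bullet> x \<le> 0" for k
        using \<rho>(1) by (simp add: polar_def)
      moreover have "(\<lambda>k. \<rho> (r k) \<bullet> x) \<longlonglongrightarrow> l \<bullet> x"
        by (intro tendsto_intros l)
      ultimately show "l \<bullet> x \<le> 0"
        using LIMSEQ_le_const2 by blast
    qed
    moreover have "(\<lambda>k. h (zs (r k + n))) \<longlonglongrightarrow> h z"
      using zs_r by (rule isCont_tendsto_compose[OF has_derivative_continuous[OF h_deriv]])
    then have "(\<lambda>k. \<rho> (r k) \<bullet> h (zs (r k + n))) \<longlonglongrightarrow> l \<bullet> h z"
      by (intro tendsto_intros l)
    then have "l \<bullet> h z = 0"
      by (simp add: \<rho>(2) LIMSEQ_const_iff)
    ultimately show "h z \<in> C \<and> (\<exists>\<rho>\<in>polar C. \<rho> \<bullet> h z = 0 \<and> v = adj (h' z) \<rho>)"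
      using hz by blast
  qed
  with M K that show thesis by blast
qed

text \<open>Base point and multiplier are perturbed together, keeping complementarity exact in the
  reduced space. The variation of \<open>h'\<close> produces the term with \<open>h''\<close>, and
  the perturbation of \<open>\<rho>\<close> produces \<open>a\<close>.\<close>

lemma mem_graphical_derivative:
  assumes \<rho>: "\<rho> \<in> polar C" and u: "u \<in> critical_cone \<Theta> zbar (adj (h' zbar) \<rho>)"
    and a: "a \<in> polar (critical_cone \<Theta> zbar (adj (h' zbar) \<rho>))" "a \<bullet> u = 0"
  shows "adj (h'' u) \<rho> + a \<in> graphical_derivative (normal_cone \<Theta>) zbar (adj (h' zbar) \<rho>) u"
proof -
  let ?A = "h' zbar"
  have u': "?A u \<in> C" "\<rho> \<bullet> ?A u = 0"
    using u by (auto simp: critical_cone_zbar)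
  have a': "a \<bullet> w \<le> 0" if "?A w \<in> C" "\<rho> \<bullet> ?A w = 0" for w
    using a(1) that by (auto simp: critical_cone_zbar polar_def)
  \<comment> \<open>The kernel of \<open>?A\<close> is a subspace contained in the critical
    cone.\<close>
  have "a \<bullet> w = 0" if "?A w = 0" for w
    using a'[of w] a'[of "- w"] that zero_mem_C by (simp add: blinfun.minus_right)
  then obtain \<alpha> where \<alpha>: "a = adj ?A \<alpha>"
    using range_adj_if_annihilates_kernel[OF h'_surj] by metis
  have \<alpha>_polar: "\<alpha> \<in> polar (C \<inter> {\<rho>}\<^sup>\<bottom>)"
    unfolding polar_def
  proof safe
    fix e assume e: "e \<in> C" "e \<in> {\<rho>}\<^sup>\<bottom>"
    obtain w where "e = ?A w"
      using h'_surj by (meson surjE)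
    then show "\<alpha> \<bullet> e \<le> 0"
      using a'[of w] e by (simp add: \<alpha> adj_inner orthogonal_comp_def orthogonal_def)
  qed
  define t where "t k = inverse (real (Suc k))" for k
  have t: "t \<longlonglongrightarrow> 0" "\<And>k. 0 < t k"
    unfolding t_def by (rule inverse_Suc_sequence)+
  have "\<alpha> \<bullet> ?A u = 0"
    using a(2) by (simp add: \<alpha> adj_inner)
  then obtain c b where c: "c \<longlonglongrightarrow> ?A u" "\<And>k. c k \<in> C" and b: "b \<longlonglongrightarrow> \<alpha>"
    "\<And>k. \<rho> + t k *\<^sub>R b k \<in> polar C" "\<And>k. (\<rho> + t k *\<^sub>R b k) \<bullet> c k = 0"
    using complementary_tangent_sequences[OF closed_C convex_C cone_C \<rho> u' \<alpha>_polar _ t] by metis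
  obtain ws where ws: "ws \<longlonglongrightarrow> u" "\<forall>\<^sub>F k in sequentially. h (zbar + t k *\<^sub>R ws k) = h zbar + t k *\<^sub>R c k"
    using submersion_lift_sequence[OF h_deriv h'_cont h'_surj t c(1)] by metis
  define z where "z k = zbar + t k *\<^sub>R ws k" for k
  have z: "z \<longlonglongrightarrow> zbar"
    unfolding z_def by (rule tendsto_add_scaleR[OF t(1) ws(1)])
  \<comment> \<open>The quotient of the normal at \<open>z k\<close> minus
    \<open>adj ?A \<rho>\<close>, split into the variation of \<open>h'\<close> and the variation of
    the coefficient.\<close>
  define \<eta> where "\<eta> k = adj ((h' (z k) - ?A) /\<^sub>R t k) \<rho> + adj (h' (z k)) (b k)" for k
  have "\<eta> \<longlonglongrightarrow> adj (h'' u) \<rho> + adj ?A \<alpha>"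
    unfolding \<eta>_def
    by (intro tendsto_add adj.tendsto tendsto_const tendsto_h' z b
        has_derivative_sequence_quotient[OF h'_deriv t ws(1), folded z_def])
  then have "(\<lambda>k. (ws k, \<eta> k)) \<longlonglongrightarrow> (u, adj (h'' u) \<rho> + a)"
    unfolding \<alpha> by (intro tendsto_Pair ws)
  moreover have "\<forall>\<^sub>F k in sequentially. (zbar, adj ?A \<rho>) + t k *\<^sub>R (ws k, \<eta> k) \<in> gph (normal_cone \<Theta>)"
    using ws(2) topological_tendstoD[OF z open_N zbar_N]
  proof eventually_elim
    case (elim k)
    have hz: "h (z k) = t k *\<^sub>R c k"
      using elim(1) by (simp add: z_def h_zbar)
    have "z k \<in> \<Theta>"
      using elim(2) c(2)[of k] t(2)[of k] by (simp add: \<Theta>_iff hz scaleR_mem_C_iff)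
    moreover have "adj (h' (z k)) (\<rho> + t k *\<^sub>R b k) \<in> regular_normal_cone \<Theta> (z k)"
      by (rule adj_mem_regular_normal_cone) (auto simp: elim(2) b hz)
    moreover have "adj (h' (z k)) (\<rho> + t k *\<^sub>R b k) = adj ?A \<rho> + t k *\<^sub>R \<eta> k"
      using t(2)[of k] by (simp add: \<eta>_def adj.scaleR_left adj.scaleR_right adj.add_right adj.diff_left scaleR_add_right)
    ultimately show ?case
      using regular_normal_cone_subset by (auto simp: gph_def z_def)
  qed
  ultimately show ?thesis
    unfolding graphical_derivative_def using t by (auto intro: tangent_cone_eventuallyI)
qed

end

section \<open>Noncriticality implies semi-isolated calmness\<close>

context variational_system
begin

section \<open>Limiting directions extracted from a failure of semi-isolated calmness\<close>

lemma calm_multiplier_mapE: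
  assumes "calm_at (multiplier_map f \<Phi> \<Theta> xbar) (0, 0) \<mu>bar"
  obtains l r where "l \<ge> 0" "r > 0"
    "\<And>\<mu> w. \<lbrakk>dist \<mu> \<mu>bar < r; dist (Psi f \<Phi> xbar \<mu>, w) (0, 0) < r; \<mu> \<in> normal_cone \<Theta> (\<Phi> xbar + w)\<rbrakk>
      \<Longrightarrow> infdist \<mu> (multipliers f \<Phi> \<Theta> xbar) \<le> l * (norm (Psi f \<Phi> xbar \<mu>) + norm w)"
proof -
  let ?M = "multiplier_map f \<Phi> \<Theta> xbar" and ?L = "multipliers f \<Phi> \<Theta> xbar"
  obtain l U V where "l \<ge> 0" and UV: "(0, 0) \<in> interior U" "\<mu>bar \<in> interior V"
    and incl: "\<forall>p\<in>U. ?M p \<inter> V \<subseteq> ?M (0, 0) + cball 0 (l * norm (p - (0, 0)))"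
    using assms unfolding calm_at_def by blast
  obtain r1 r2 where r: "r1 > 0" "r2 > 0" "ball (0, 0) r1 \<subseteq> U" "ball \<mu>bar r2 \<subseteq> V"
    using UV unfolding mem_interior by blast
  show thesis
  proof (rule that[of l "min r1 r2"])
    fix \<mu> w
    assume *: "dist \<mu> \<mu>bar < min r1 r2" "dist (Psi f \<Phi> xbar \<mu>, w) (0, 0) < min r1 r2"
      "\<mu> \<in> normal_cone \<Theta> (\<Phi> xbar + w)"
    let ?p = "(Psi f \<Phi> xbar \<mu>, w)"
    have "?p \<in> U" "\<mu> \<in> V" "\<mu> \<in> ?M ?p"
      using * r(3,4) by (auto simp: subset_iff dist_commute multiplier_map_def)
    then have "\<mu> \<in> ?M (0, 0) + cball 0 (l * norm (?p - (0, 0)))"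
      using incl by blast
    moreover have "?M (0, 0) = ?L"
      by (auto simp: multiplier_map_def multipliers_def)
    ultimately have "\<mu> \<in> ?L + cball 0 (l * norm ?p)"
      by (simp flip: zero_prod_def)
    then obtain \<nu> b where \<nu>: "\<nu> \<in> ?L" "b \<in> cball 0 (l * norm ?p)" "\<mu> = \<nu> + b"
      by (rule set_plus_elim)
    then have "infdist \<mu> ?L \<le> l * norm ?p"
      using infdist_le[of \<nu> ?L \<mu>] by (simp add: dist_norm)
    also have "\<dots> \<le> l * (norm (Psi f \<Phi> xbar \<mu>) + norm w)"
      using \<open>l \<ge> 0\<close> by (intro mult_left_mono) (simp_all add: norm_Pair sqrt_sum_squares_le_sum)
    finally show "infdist \<mu> ?L \<le> l * (norm (Psi f \<Phi> xbar \<mu>) + norm w)" .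
  qed (use \<open>l \<ge> 0\<close> r in auto)
qed

text \<open>Calmness is refuted for radius 1/(k+1) and modulus k+1, with all \<open>v\<close>
  allowed and \<open>w\<close> in the ball of that radius.\<close>

lemma not_semi_isolated_calmE:
  assumes "\<not> semi_isolated_calm f \<Phi> \<Theta> xbar \<mu>bar"
  obtains x \<mu> w where "x \<longlonglongrightarrow> xbar" "\<mu> \<longlonglongrightarrow> \<mu>bar" "w \<longlonglongrightarrow> 0"
    "\<And>k. \<mu> k \<in> normal_cone \<Theta> (\<Phi> (x k) + w k)"
    "\<And>k. real (Suc k) * (norm (Psi f \<Phi> (x k) (\<mu> k)) + norm (w k))
      < norm (x k - xbar) + infdist (\<mu> k) (multipliers f \<Phi> \<Theta> xbar)"
proof -
  let ?L = "multipliers f \<Phi> \<Theta> xbar"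
  define e where "e k = inverse (real (Suc k))" for k
  have e: "e \<longlonglongrightarrow> 0" "\<And>k. 0 < e k"
    unfolding e_def by (rule inverse_Suc_sequence)+
  have "\<exists>x \<mu> w. dist (x, \<mu>) (xbar, \<mu>bar) \<le> e k \<and> norm w < e k \<and> \<mu> \<in> normal_cone \<Theta> (\<Phi> x + w)
    \<and> real (Suc k) * (norm (Psi f \<Phi> x \<mu>) + norm w) < norm (x - xbar) + infdist \<mu> ?L" for k
  proof (rule ccontr)
    assume none: "\<not> ?thesis"
    have "solution_map f \<Phi> \<Theta> (v, w) \<inter> cball (xbar, \<mu>bar) (e k)
        \<subseteq> {xbar} \<times> ?L + cball 0 (real (Suc k) * (norm v + norm w))" if "norm w < e k" for v w
    proof clarify
      fix x \<mu> assume sol: "(x, \<mu>) \<in> solution_map f \<Phi> \<Theta> (v, w)" and "(x, \<mu>) \<in> cball (xbar, \<mu>bar) (e k)"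
      then have "dist (x, \<mu>) (xbar, \<mu>bar) \<le> e k" "\<mu> \<in> normal_cone \<Theta> (\<Phi> x + w)" "v = Psi f \<Phi> x \<mu>"
        by (auto simp: solution_map_def dist_commute)
      with none that have "norm (x - xbar) + infdist \<mu> ?L \<le> real (Suc k) * (norm v + norm w)"
        using not_less by blast
      then show "(x, \<mu>) \<in> {xbar} \<times> ?L + cball 0 (real (Suc k) * (norm v + norm w))"
        by (rule mem_Lambda_plus_cballI)
    qed
    then have "semi_isolated_calm f \<Phi> \<Theta> xbar \<mu>bar"
      unfolding semi_isolated_calm_def using e(2)[of k]
      by (intro exI[of _ "e k"] exI[of _ "real (Suc k)"] exI[of _ UNIV] exI[of _ "ball 0 (e k)"] conjI) auto
    then show False
      using assms by contradiction
  qed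
  then obtain x \<mu> w where xw: "\<And>k. dist (x k, \<mu> k) (xbar, \<mu>bar) \<le> e k" "\<And>k. norm (w k) < e k"
    "\<And>k. \<mu> k \<in> normal_cone \<Theta> (\<Phi> (x k) + w k)"
    "\<And>k. real (Suc k) * (norm (Psi f \<Phi> (x k) (\<mu> k)) + norm (w k)) < norm (x k - xbar) + infdist (\<mu> k) ?L"
    by metis
  have "(\<lambda>k. (x k, \<mu> k) - (xbar, \<mu>bar)) \<longlonglongrightarrow> 0"
    using xw(1) by (intro Lim_null_comparison[OF always_eventually e(1)]) (simp add: dist_norm)
  then have "(\<lambda>k. (x k, \<mu> k)) \<longlonglongrightarrow> (xbar, \<mu>bar)"
    by (rule Lim_null[THEN iffD2])
  then have "x \<longlonglongrightarrow> xbar" "\<mu> \<longlonglongrightarrow> \<mu>bar"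
    using tendsto_fst tendsto_snd by fastforce+
  moreover have "w \<longlonglongrightarrow> 0"
    using xw(2) by (intro Lim_null_comparison[OF always_eventually e(1)]) (simp add: less_imp_le)
  ultimately show thesis
    using that xw(3,4) by blast
qed

lemma not_semi_isolated_calm_directionsE:
  assumes calm: "calm_at (multiplier_map f \<Phi> \<Theta> xbar) (0, 0) \<mu>bar"
    and "\<not> semi_isolated_calm f \<Phi> \<Theta> xbar \<mu>bar"
  obtains t :: "nat \<Rightarrow> real" and \<xi> \<xi>0 \<nu> \<eta> \<eta>0 w where "t \<longlonglongrightarrow> 0" "\<And>k. 0 < t k" "\<xi> \<longlonglongrightarrow> \<xi>0" "\<xi>0 \<noteq> 0" "\<eta> \<longlonglongrightarrow> \<eta>0" "w \<longlonglongrightarrow> 0"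
    "\<And>k. \<nu> k \<in> multipliers f \<Phi> \<Theta> xbar" "\<nu> \<longlonglongrightarrow> \<mu>bar"
    "\<And>k. \<nu> k + t k *\<^sub>R \<eta> k \<in> normal_cone \<Theta> (\<Phi> (xbar + t k *\<^sub>R \<xi> k) + t k *\<^sub>R w k)"
    "(\<lambda>k. Psi f \<Phi> (xbar + t k *\<^sub>R \<xi> k) (\<nu> k + t k *\<^sub>R \<eta> k) /\<^sub>R t k) \<longlonglongrightarrow> 0"
proof -
  let ?L = "multipliers f \<Phi> \<Theta> xbar"
  obtain x \<mu> w where x: "x \<longlonglongrightarrow> xbar" and \<mu>: "\<mu> \<longlonglongrightarrow> \<mu>bar" and w: "w \<longlonglongrightarrow> 0"
    and mem: "\<And>k. \<mu> k \<in> normal_cone \<Theta> (\<Phi> (x k) + w k)"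
    and strict: "\<And>k. real (Suc k) * (norm (Psi f \<Phi> (x k) (\<mu> k)) + norm (w k)) < norm (x k - xbar) + infdist (\<mu> k) ?L"
    using not_semi_isolated_calmE[OF assms(2)] by blast
  obtain l r where "l \<ge> 0" "r > 0" and bound:
    "\<And>\<mu> w. \<lbrakk>dist \<mu> \<mu>bar < r; dist (Psi f \<Phi> xbar \<mu>, w) (0, 0) < r; \<mu> \<in> normal_cone \<Theta> (\<Phi> xbar + w)\<rbrakk>
      \<Longrightarrow> infdist \<mu> ?L \<le> l * (norm (Psi f \<Phi> xbar \<mu>) + norm w)"
    using calm_multiplier_mapE[OF calm] by metis
  have Psi0: "Psi f \<Phi> xbar \<mu>bar = 0"
    using solution by (simp add: multipliers_def)
  define w' where "w' k = \<Phi> (x k) - \<Phi> xbar + w k" for k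
  have "w' \<longlonglongrightarrow> \<Phi> xbar - \<Phi> xbar + 0"
    unfolding w'_def by (intro tendsto_intros tendsto_\<Phi> x w)
  moreover have "(\<lambda>k. Psi f \<Phi> xbar (\<mu> k)) \<longlonglongrightarrow> 0"
    using tendsto_Psi[OF tendsto_const \<mu>, of xbar] by (simp add: Psi0)
  ultimately have "(\<lambda>k. (Psi f \<Phi> xbar (\<mu> k), w' k)) \<longlonglongrightarrow> (0, 0)"
    by (intro tendsto_Pair) simp_all
  from tendstoD[OF this \<open>r > 0\<close>] tendstoD[OF \<mu> \<open>r > 0\<close>]
  have ev1: "\<forall>\<^sub>F k in sequentially. infdist (\<mu> k) ?L \<le> l * (norm (Psi f \<Phi> xbar (\<mu> k)) + norm (w' k))"
  proof eventually_elim
    case (elim k)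
    then show ?case
      using mem[of k] by (intro bound) (simp_all add: w'_def)
  qed
  have "\<forall>\<^sub>F k in sequentially. x k \<noteq> xbar \<and> infdist (\<mu> k) ?L \<le> l * (norm (Psi f \<Phi> xbar (\<mu> k)) + norm (w' k))"
    using ev1 eventually_ge_at_top[of "nat \<lceil>l\<rceil>"]
  proof eventually_elim
    case (elim k)
    \<comment> \<open>At \<open>x k = xbar\<close> calmness of the multiplier map would give the
      estimate with modulus \<open>l\<close>, contrary to its failure with modulus k+1 once k is at
      least \<open>l\<close>.\<close>
    have "x k \<noteq> xbar"
    proof
      assume eq: "x k = xbar"
      then have "infdist (\<mu> k) ?L \<le> l * (norm (Psi f \<Phi> (x k) (\<mu> k)) + norm (w k))"
        using elim(1) by (simp add: w'_def)
      also have "\<dots> \<le> real (Suc k) * (norm (Psi f \<Phi> (x k) (\<mu> k)) + norm (w k))"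
        using elim(2) by (intro mult_right_mono add_nonneg_nonneg norm_ge_zero) linarith
      finally show False
        using strict[of k] eq by simp
    qed
    then show ?case
      using elim(1) by simp
  qed
  then obtain n where n: "\<And>k. k \<ge> n \<Longrightarrow> x k \<noteq> xbar"
    "\<And>k. k \<ge> n \<Longrightarrow> infdist (\<mu> k) ?L \<le> l * (norm (Psi f \<Phi> xbar (\<mu> k)) + norm (w' k))"
    unfolding eventually_sequentially by blast
  have "bounded (range (\<lambda>k. sgn (x (k + n) - xbar)))"
    by (auto intro!: boundedI[of _ 1] simp: norm_sgn)
  then obtain r0 \<xi>0 where r0: "strict_mono r0" "((\<lambda>k. sgn (x (k + n) - xbar)) \<circ> r0) \<longlonglongrightarrow> \<xi>0"
    using bounded_imp_convergent_subsequence by blast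
  \<comment> \<open>The shift by \<open>n\<close> secures the eventual properties for every index,
    and \<open>q k \<ge> k\<close> keeps the growing modulus.\<close>
  define q where "q k = r0 k + n" for k
  have q: "strict_mono q" "q k \<ge> k" "q k \<ge> n" for k
    using r0(1) seq_suble[OF r0(1), of k] by (auto simp: q_def strict_mono_def intro: trans_le_add1)
  define t where "t k = norm (x (q k) - xbar)" for k
  define \<xi> where "\<xi> k = sgn (x (q k) - xbar)" for k
  have \<xi>: "\<xi> \<longlonglongrightarrow> \<xi>0"
    using r0(2) by (simp add: \<xi>_def[abs_def] q_def o_def)
  have x_eq: "xbar + t k *\<^sub>R \<xi> k = x (q k)" for k
    using n(1)[OF q(3)[of k]] by (simp add: t_def \<xi>_def sgn_div_norm)
  have t_pos: "0 < t k" for k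
    using n(1)[OF q(3)] by (simp add: t_def)
  have xq: "(\<lambda>k. x (q k)) \<longlonglongrightarrow> xbar" and \<mu>q: "(\<lambda>k. \<mu> (q k)) \<longlonglongrightarrow> \<mu>bar"
    using LIMSEQ_subseq_LIMSEQ[OF x q(1)] LIMSEQ_subseq_LIMSEQ[OF \<mu> q(1)] by (auto simp: o_def)
  have t: "t \<longlonglongrightarrow> 0"
    using tendsto_norm_zero[OF LIM_zero[OF xq]] by (simp add: t_def[abs_def])
  have "(\<lambda>k. norm (\<xi> k)) \<longlonglongrightarrow> norm \<xi>0"
    by (intro tendsto_intros \<xi>)
  moreover have "norm (\<xi> k) = 1" for k
    using n(1)[OF q(3)] by (simp add: \<xi>_def norm_sgn)
  ultimately have "\<xi>0 \<noteq> 0"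
    by (auto simp: LIMSEQ_const_iff)
  \<comment> \<open>The cost, relative to \<open>t k\<close>, of replacing \<open>x (q k)\<close> by
    \<open>xbar\<close> in the residual and in \<open>\<Phi>\<close>; it converges and is therefore
    bounded.\<close>
  define \<beta> where "\<beta> k = norm ((Psi f \<Phi> (x (q k)) (\<mu> (q k)) - Psi f \<Phi> xbar (\<mu> (q k))) /\<^sub>R t k)
      + norm ((\<Phi> (x (q k)) - \<Phi> xbar) /\<^sub>R t k)" for k
  have "\<beta> \<longlonglongrightarrow> norm (nabla (\<lambda>u. Psi f \<Phi> u \<mu>bar) xbar \<xi>0) + norm (\<Phi>' xbar \<xi>0)"
    unfolding \<beta>_def[abs_def] x_eq[symmetric]
    by (intro tendsto_add tendsto_norm Psi_quotient[OF t t_pos \<xi> \<mu>q]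
        has_derivative_sequence_quotient[OF \<Phi>_deriv t t_pos \<xi>])
  then have "Bseq \<beta>"
    using convergentI convergent_imp_Bseq by blast
  then obtain b where b: "\<And>k. \<beta> k \<le> b"
    unfolding Bseq_def by (metis abs_le_D1 real_norm_def)
  define s where "s k = (norm (Psi f \<Phi> (x (q k)) (\<mu> (q k))) + norm (w (q k))) / t k" for k
  have s_nonneg: "0 \<le> s k" for k
    using t_pos[of k] by (simp add: s_def)
  have inf_le: "infdist (\<mu> (q k)) ?L / t k \<le> l * (s k + b)" for k
  proof -
    let ?P = "Psi f \<Phi> (x (q k)) (\<mu> (q k))" and ?P' = "Psi f \<Phi> xbar (\<mu> (q k))"
    have "norm ?P' \<le> norm ?P + norm (?P - ?P')"
      by (metis norm_minus_commute norm_triangle_sub)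
    moreover have "norm (w' (q k)) \<le> norm (w (q k)) + norm (\<Phi> (x (q k)) - \<Phi> xbar)"
      unfolding w'_def using norm_triangle_ineq by (metis add.commute)
    moreover have "t k * \<beta> k = norm (?P - ?P') + norm (\<Phi> (x (q k)) - \<Phi> xbar)"
      using t_pos[of k] by (simp add: \<beta>_def distrib_left flip: mult.assoc)
    moreover have "t k * s k = norm ?P + norm (w (q k))"
      using t_pos[of k] by (simp add: s_def)
    ultimately have "norm ?P' + norm (w' (q k)) \<le> t k * (s k + \<beta> k)"
      by (simp add: distrib_left)
    also have "\<dots> \<le> t k * (s k + b)"
      using t_pos[of k] b[of k] by simp
    finally have "l * (norm ?P' + norm (w' (q k))) \<le> l * (t k * (s k + b))"
      using \<open>l \<ge> 0\<close> by (rule mult_left_mono)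
    with n(2)[OF q(3)[of k]] have "infdist (\<mu> (q k)) ?L \<le> l * (s k + b) * t k"
      by (simp add: mult_ac)
    then show ?thesis
      using t_pos[of k] by (simp add: pos_divide_le_eq)
  qed
  \<comment> \<open>The failed estimate divided by \<open>t k\<close>, with the distance to the
    multipliers bounded by calmness.\<close>
  have s_le: "real (Suc k) * s k \<le> 1 + l * (s k + b)" for k
  proof -
    have "real (Suc k) * s k \<le> real (Suc (q k)) * s k"
      using q(2)[of k] s_nonneg by (intro mult_right_mono) auto
    also have "\<dots> = real (Suc (q k)) * (norm (Psi f \<Phi> (x (q k)) (\<mu> (q k))) + norm (w (q k))) / t k"
      by (simp add: s_def)
    also have "\<dots> \<le> (t k + infdist (\<mu> (q k)) ?L) / t k"
      using strict[of "q k"] t_pos[of k] by (intro divide_right_mono) (simp_all add: t_def)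
    also have "\<dots> \<le> 1 + l * (s k + b)"
      using inf_le[of k] t_pos[of k] by (simp add: add_divide_distrib)
    finally show ?thesis .
  qed
  have "\<forall>\<^sub>F k in sequentially. norm (s k) \<le> 2 * (1 + l * b) * inverse (real (Suc k))"
    using eventually_ge_at_top[of "nat \<lceil>2 * l\<rceil>"]
  proof eventually_elim
    case (elim k)
    \<comment> \<open>For such k the term \<open>l * s k\<close> is absorbed into half of the left
      side of \<open>s_le\<close>, which makes \<open>s k\<close> of order 1/k.\<close>
    then have "2 * l \<le> real (Suc k)"
      by linarith
    then have "2 * l * s k \<le> real (Suc k) * s k"
      using s_nonneg by (rule mult_right_mono)
    then have "real (Suc k) * s k \<le> 2 * (1 + l * b)"
      using s_le[of k] by (simp add: distrib_left)
    then show ?case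
      using s_nonneg[of k] by (simp add: field_simps)
  qed
  moreover have "(\<lambda>k. 2 * (1 + l * b) * inverse (real (Suc k))) \<longlonglongrightarrow> 0"
    by (rule tendsto_mult_right_zero[OF LIMSEQ_inverse_real_of_nat])
  ultimately have s: "s \<longlonglongrightarrow> 0"
    by (rule Lim_null_comparison)
  \<comment> \<open>Nearest multipliers make \<open>\<eta> k\<close> exactly as long as the scaled
    distance just bounded, so a second subsequence gives \<open>\<eta>0\<close>.\<close>
  have "\<exists>\<nu>\<in>?L. infdist (\<mu> (q k)) ?L = dist (\<mu> (q k)) \<nu>" for k
    using infdist_attains_inf[OF Lambda_closed, of "\<mu> (q k)"] solution by blast
  then obtain \<nu> where \<nu>: "\<And>k. \<nu> k \<in> ?L" "\<And>k. infdist (\<mu> (q k)) ?L = dist (\<mu> (q k)) (\<nu> k)"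
    by metis
  define \<eta> where "\<eta> k = (\<mu> (q k) - \<nu> k) /\<^sub>R t k" for k
  have \<mu>_eq: "\<nu> k + t k *\<^sub>R \<eta> k = \<mu> (q k)" for k
    using t_pos[of k] by (simp add: \<eta>_def)
  have "Bseq s"
    using s convergentI convergent_imp_Bseq by blast
  then obtain b' where b': "\<And>k. s k \<le> b'"
    unfolding Bseq_def by (metis abs_le_D1 real_norm_def)
  have "norm (\<eta> k) \<le> l * (b' + b)" for k
  proof -
    have "norm (\<eta> k) \<le> l * (s k + b)"
      using inf_le[of k] t_pos[of k] by (simp add: \<eta>_def \<nu>(2) dist_norm divide_inverse mult.commute)
    also have "\<dots> \<le> l * (b' + b)"
      using b'[of k] \<open>l \<ge> 0\<close> by (simp add: mult_left_mono)
    finally show ?thesis .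
  qed
  then have "bounded (range \<eta>)"
    by (auto intro!: boundedI)
  then obtain r1 \<eta>0 where r1: "strict_mono r1" "(\<eta> \<circ> r1) \<longlonglongrightarrow> \<eta>0"
    using bounded_imp_convergent_subsequence by blast
  have tr: "(\<lambda>k. t (r1 k)) \<longlonglongrightarrow> 0"
    using LIMSEQ_subseq_LIMSEQ[OF t r1(1)] by (simp add: o_def)
  have \<xi>r: "(\<lambda>k. \<xi> (r1 k)) \<longlonglongrightarrow> \<xi>0"
    using LIMSEQ_subseq_LIMSEQ[OF \<xi> r1(1)] by (simp add: o_def)
  have sr: "(\<lambda>k. s (r1 k)) \<longlonglongrightarrow> 0"
    using LIMSEQ_subseq_LIMSEQ[OF s r1(1)] by (simp add: o_def)
  have \<eta>r: "(\<lambda>k. \<eta> (r1 k)) \<longlonglongrightarrow> \<eta>0"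
    using r1(2) by (simp add: o_def)
  have \<mu>r: "(\<lambda>k. \<mu> (q (r1 k))) \<longlonglongrightarrow> \<mu>bar"
    using LIMSEQ_subseq_LIMSEQ[OF \<mu>q r1(1)] by (simp add: o_def)
  have "(\<lambda>k. \<mu> (q (r1 k)) - t (r1 k) *\<^sub>R \<eta> (r1 k)) \<longlonglongrightarrow> \<mu>bar - 0 *\<^sub>R \<eta>0"
    by (intro tendsto_intros \<mu>r tr \<eta>r)
  then have \<nu>r: "(\<lambda>k. \<nu> (r1 k)) \<longlonglongrightarrow> \<mu>bar"
    by (simp flip: \<mu>_eq)
  have P_le: "norm (Psi f \<Phi> (x (q k)) (\<mu> (q k)) /\<^sub>R t k) \<le> s k"
    and w_le: "norm (w (q k) /\<^sub>R t k) \<le> s k" for k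
    using t_pos[of k] by (auto simp: s_def divide_inverse mult.commute)
  show thesis
  proof (rule that[OF tr t_pos \<xi>r \<open>\<xi>0 \<noteq> 0\<close> \<eta>r _ \<nu>(1) \<nu>r])
    show "(\<lambda>k. w (q (r1 k)) /\<^sub>R t (r1 k)) \<longlonglongrightarrow> 0"
      by (rule Lim_null_comparison[OF always_eventually sr]) (use w_le in blast)
    show "\<nu> (r1 k) + t (r1 k) *\<^sub>R \<eta> (r1 k)
        \<in> normal_cone \<Theta> (\<Phi> (xbar + t (r1 k) *\<^sub>R \<xi> (r1 k)) + t (r1 k) *\<^sub>R (w (q (r1 k)) /\<^sub>R t (r1 k)))" for k
      unfolding x_eq \<mu>_eq using mem t_pos[of "r1 k"] by simp
    show "(\<lambda>k. Psi f \<Phi> (xbar + t (r1 k) *\<^sub>R \<xi> (r1 k)) (\<nu> (r1 k) + t (r1 k) *\<^sub>R \<eta> (r1 k)) /\<^sub>R t (r1 k)) \<longlonglongrightarrow> 0"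
      unfolding x_eq \<mu>_eq
      by (rule Lim_null_comparison[OF always_eventually sr]) (use P_le in blast)
  qed
qed

section \<open>Passage to the limit in the reduced coordinates\<close>

lemma noncritical_direction_eq_zero:
  assumes red: "cone_reduction \<Theta> N C h h' h'' (\<Phi> xbar)"
    and closed_diff: "closed (minkowski_diff (polar (critical_cone \<Theta> (\<Phi> xbar) \<mu>bar))
          (polar (critical_cone \<Theta> (\<Phi> xbar) \<mu>bar) \<inter> {\<eta>. adj (\<Phi>' xbar) \<eta> = 0}))"
    and noncritical: "noncritical f \<Phi> \<Theta> xbar \<mu>bar"
    and t: "t \<longlonglongrightarrow> 0" "\<And>k. 0 < t k" and \<xi>: "\<xi> \<longlonglongrightarrow> \<xi>0" and \<eta>: "\<eta> \<longlonglongrightarrow> \<eta>0" and w: "w \<longlonglongrightarrow> 0"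
    and \<nu>: "\<And>k. \<nu> k \<in> multipliers f \<Phi> \<Theta> xbar" "\<nu> \<longlonglongrightarrow> \<mu>bar"
    and mem: "\<And>k. \<nu> k + t k *\<^sub>R \<eta> k \<in> normal_cone \<Theta> (\<Phi> (xbar + t k *\<^sub>R \<xi> k) + t k *\<^sub>R w k)"
    and P: "(\<lambda>k. Psi f \<Phi> (xbar + t k *\<^sub>R \<xi> k) (\<nu> k + t k *\<^sub>R \<eta> k) /\<^sub>R t k) \<longlonglongrightarrow> 0"
  shows "\<xi>0 = 0"
proof -
  interpret red: cone_reduction \<Theta> N C h h' h'' "\<Phi> xbar" by (rule red)
  let ?z = "\<Phi> xbar" and ?A = "h' (\<Phi> xbar)"
  let ?K = "critical_cone \<Theta> ?z \<mu>bar"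
  define u where "u = \<Phi>' xbar \<xi>0"
  define \<mu> where "\<mu> k = \<nu> k + t k *\<^sub>R \<eta> k" for k
  have \<mu>: "\<mu> \<longlonglongrightarrow> \<mu>bar"
    using tendsto_add[OF \<nu>(2) tendsto_scaleR[OF t(1) \<eta>]] by (simp add: \<mu>_def[abs_def])
  \<comment> \<open>The perturbed base points are \<open>z k = ?z + t k *\<^sub>R v k\<close>, so
    \<open>v k\<close> includes the vanishing perturbation and converges to the image
    \<open>u\<close> of \<open>\<xi>0\<close>.\<close>
  define v where "v k = (\<Phi> (xbar + t k *\<^sub>R \<xi> k) - \<Phi> xbar) /\<^sub>R t k + w k" for k
  have v: "v \<longlonglongrightarrow> u"
    using tendsto_add[OF has_derivative_sequence_quotient[OF \<Phi>_deriv t \<xi>] w]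
    by (simp add: v_def[abs_def] u_def)
  define z where "z k = ?z + t k *\<^sub>R v k" for k
  have z: "z \<longlonglongrightarrow> ?z"
    unfolding z_def by (rule red.tendsto_add_scaleR[OF t(1) v])
  have z_eq: "\<Phi> (xbar + t k *\<^sub>R \<xi> k) + t k *\<^sub>R w k = z k" for k
    using t(2)[of k] by (simp add: z_def v_def scaleR_add_right)
  have \<mu>_mem: "\<mu> k \<in> normal_cone \<Theta> (z k)" for k
    using mem[of k] by (simp add: z_eq \<mu>_def)
  obtain M K where M: "open M" "?z \<in> M" and "K > 0"
    and K: "\<And>z \<rho>. z \<in> M \<Longrightarrow> norm \<rho> \<le> K * norm (adj (h' z) \<rho>)"
    and rep: "\<And>z v. z \<in> M \<Longrightarrow> v \<in> normal_cone \<Theta> z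
       \<longleftrightarrow> h z \<in> C \<and> (\<exists>\<rho>\<in>polar C. \<rho> \<bullet> h z = 0 \<and> v = adj (h' z) \<rho>)"
    using red.normal_cone_near_zbar by metis
  have zM: "\<forall>\<^sub>F k in sequentially. z k \<in> M"
    by (rule topological_tendstoD[OF z M])
  have "\<mu>bar \<in> normal_cone \<Theta> ?z"
    using solution by (simp add: multipliers_def)
  then obtain \<rho>0 where \<rho>0: "\<rho>0 \<in> polar C" "\<mu>bar = adj ?A \<rho>0"
    using rep[OF M(2)] by blast
  have "\<exists>\<sigma>. \<sigma> \<in> polar C \<and> \<nu> k = adj ?A \<sigma>" for k
    using rep[OF M(2)] \<nu>(1)[of k] by (auto simp: multipliers_def)
  then obtain \<sigma> where \<sigma>: "\<And>k. \<sigma> k \<in> polar C" "\<And>k. \<nu> k = adj ?A (\<sigma> k)"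
    by metis
  have "\<exists>\<rho>. z k \<in> M \<longrightarrow> \<rho> \<in> polar C \<and> \<rho> \<bullet> h (z k) = 0 \<and> \<mu> k = adj (h' (z k)) \<rho>" for k
    using rep \<mu>_mem by blast
  then obtain \<rho> where \<rho>: "\<And>k. z k \<in> M \<Longrightarrow> \<rho> k \<in> polar C" "\<And>k. z k \<in> M \<Longrightarrow> \<rho> k \<bullet> h (z k) = 0"
    "\<And>k. z k \<in> M \<Longrightarrow> \<mu> k = adj (h' (z k)) (\<rho> k)"
    by metis
  have hzC: "h (z k) \<in> C" if "z k \<in> M" for k
    using rep[OF that] \<mu>_mem by blast
  \<comment> \<open>The lower bound for the adjoint of \<open>h' (z k)\<close> turns convergence of
    the normals into convergence of their coefficients.\<close>
  have \<rho>lim: "\<rho> \<longlonglongrightarrow> \<rho>0"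
  proof -
    have "(\<lambda>k. \<mu> k - adj (h' (z k)) \<rho>0) \<longlonglongrightarrow> \<mu>bar - adj ?A \<rho>0"
      by (intro tendsto_diff \<mu> adj.tendsto red.tendsto_h' z tendsto_const)
    then have "(\<lambda>k. K * norm (\<mu> k - adj (h' (z k)) \<rho>0)) \<longlonglongrightarrow> 0"
      by (intro tendsto_mult_right_zero tendsto_norm_zero) (simp add: \<rho>0(2))
    moreover have "\<forall>\<^sub>F k in sequentially. norm (\<rho> k - \<rho>0) \<le> K * norm (\<mu> k - adj (h' (z k)) \<rho>0)"
      using zM by eventually_elim (metis K \<rho>(3) adj.diff_right)
    ultimately have "(\<lambda>k. \<rho> k - \<rho>0) \<longlonglongrightarrow> 0"
      by (rule Lim_null_comparison[rotated])
    then show ?thesis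
      by (rule Lim_null[THEN iffD2])
  qed
  define \<tau> where "\<tau> k = (\<rho> k - \<sigma> k) /\<^sub>R t k" for k
  \<comment> \<open>What remains of \<open>\<eta>0\<close> after the second-order term caused by the
    change of \<open>h'\<close> between \<open>?z\<close> and \<open>z k\<close>.\<close>
  define \<delta> where "\<delta> = \<eta>0 - adj (h'' u) \<rho>0"
  have \<tau>: "(\<lambda>k. adj ?A (\<tau> k)) \<longlonglongrightarrow> \<delta>"
  proof (rule Lim_transform_eventually)
    show "(\<lambda>k. \<eta> k - adj ((h' (z k) - ?A) /\<^sub>R t k) (\<rho> k)) \<longlonglongrightarrow> \<delta>"
      unfolding \<delta>_def z_def
      by (intro tendsto_diff \<eta> adj.tendsto \<rho>lim has_derivative_sequence_quotient[OF red.h'_deriv t v])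
    show "\<forall>\<^sub>F k in sequentially. \<eta> k - adj ((h' (z k) - ?A) /\<^sub>R t k) (\<rho> k) = adj ?A (\<tau> k)"
      using zM
    proof eventually_elim
      case (elim k)
      have "\<eta> k = (\<mu> k - \<nu> k) /\<^sub>R t k"
        using t(2)[of k] by (simp add: \<mu>_def)
      also have "\<dots> = (adj (h' (z k)) (\<rho> k) - adj ?A (\<sigma> k)) /\<^sub>R t k"
        by (simp add: \<rho>(3)[OF elim] \<sigma>(2))
      finally show ?case
        by (simp add: \<tau>_def adj.scaleR_left adj.scaleR_right adj.diff_left adj.diff_right scaleR_diff_right)
    qed
  qed
  have K_iff: "y \<in> ?K \<longleftrightarrow> ?A y \<in> C \<and> \<rho>0 \<bullet> ?A y = 0" for y
    by (simp add: \<rho>0(2) red.critical_cone_zbar)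
  \<comment> \<open>On the critical cone the contribution of \<open>\<rho>0\<close> vanishes and any
    element of the polar of \<open>C\<close> contributes a nonpositive value.\<close>
  have polarI: "adj ?A ((\<sigma> - \<rho>0) /\<^sub>R t k) \<in> polar ?K" if "\<sigma> \<in> polar C" for \<sigma> k
    using that t(2)[of k] by (auto simp: polar_def K_iff adj_inner inner_diff_left mult_le_0_iff)
  have "\<forall>\<^sub>F k in sequentially. adj ?A (\<tau> k)
      \<in> minkowski_diff (polar ?K) (polar ?K \<inter> {\<eta>. adj (\<Phi>' xbar) \<eta> = 0})"
    using zM
  proof eventually_elim
    case (elim k)
    have "adj (\<Phi>' xbar) (\<nu> k - \<mu>bar) = 0"
      using Psi_diff_multiplier[of xbar "\<nu> k" \<mu>bar] \<nu>(1)[of k] solution by (simp add: multipliers_def)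
    then have "adj (\<Phi>' xbar) (adj ?A ((\<sigma> k - \<rho>0) /\<^sub>R t k)) = 0"
      by (simp add: \<sigma>(2) \<rho>0(2) adj.scaleR_right adj.diff_right)
    \<comment> \<open>Both coefficients are compared with \<open>\<rho>0\<close>; the second
      difference lies in the kernel because two multipliers at \<open>xbar\<close> differ by a
      kernel element.\<close>
    moreover have "adj ?A (\<tau> k) = adj ?A ((\<rho> k - \<rho>0) /\<^sub>R t k) - adj ?A ((\<sigma> k - \<rho>0) /\<^sub>R t k)"
      by (simp add: \<tau>_def flip: adj.diff_right scaleR_diff_right)
    ultimately show ?case
      unfolding minkowski_diff_def using polarI \<rho>(1)[OF elim] \<sigma>(1) by blast
  qed
  \<comment> \<open>The two parts of the difference need not converge separately; closedness still
    writes the limit as \<open>a - b\<close>.\<close>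
  from Lim_in_closed_set[OF closed_diff this _ \<tau>]
  obtain a b where ab: "\<delta> = a - b" "a \<in> polar ?K" "adj (\<Phi>' xbar) b = 0"
    by (auto simp: minkowski_diff_def)
  have hq: "(\<lambda>k. h (z k) /\<^sub>R t k) \<longlonglongrightarrow> ?A u"
    using has_derivative_sequence_quotient[OF red.h_deriv t v, of ?z] by (simp add: z_def red.h_zbar)
  have "?A u \<in> C"
  proof (rule Lim_in_closed_set[OF red.closed_C _ _ hq])
    show "\<forall>\<^sub>F k in sequentially. h (z k) /\<^sub>R t k \<in> C"
      using zM by eventually_elim (simp add: red.scaleR_mem_C_iff t hzC)
  qed simp
  moreover have "\<rho>0 \<bullet> ?A u = 0"
  proof (rule LIMSEQ_unique[OF tendsto_inner[OF \<rho>lim hq] Lim_transform_eventually[OF tendsto_const]])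
    show "\<forall>\<^sub>F k in sequentially. 0 = \<rho> k \<bullet> (h (z k) /\<^sub>R t k)"
      using zM by eventually_elim (simp add: \<rho>)
  qed
  ultimately have uK: "u \<in> ?K"
    by (simp add: K_iff)
  have "0 \<le> \<delta> \<bullet> u"
  proof -
    \<comment> \<open>The adjoint of \<open>B\<close> is a left inverse of \<open>adj ?A\<close>, so
      \<open>\<tau>\<close> itself converges and the sign can be read off in the reduced
      space.\<close>
    obtain B where B: "\<And>e. ?A (blinfun_apply B e) = e"
      using surj_blinfun_right_inverse[OF red.h'_surj] by blast
    have "adj B (adj ?A e) = e" for e
      by (rule adj_eqI) (simp add: inner_adj B)
    then have \<tau>lim: "\<tau> \<longlonglongrightarrow> adj B \<delta>"
      using adj.tendsto[OF tendsto_const[of B] \<tau>] by simp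
    have "(\<lambda>k. adj ?A (\<tau> k)) \<longlonglongrightarrow> adj ?A (adj B \<delta>)"
      by (intro adj.tendsto tendsto_const \<tau>lim)
    then have \<delta>_eq: "adj ?A (adj B \<delta>) = \<delta>"
      using \<tau> LIMSEQ_unique by blast
    have "\<forall>\<^sub>F k in sequentially. 0 \<le> \<tau> k \<bullet> (h (z k) /\<^sub>R t k)"
      using zM
    proof eventually_elim
      case (elim k)
      \<comment> \<open>The coefficient \<open>\<rho> k\<close> is complementary to
        \<open>h (z k)\<close> while \<open>\<sigma> k\<close> is only polar, which fixes the sign
        of the difference.\<close>
      have "\<sigma> k \<bullet> h (z k) \<le> 0"
        using \<sigma>(1)[of k] hzC[OF elim] by (simp add: polar_def)
      then show ?case
        using \<rho>(2)[OF elim] t(2)[of k] by (simp add: \<tau>_def inner_diff_left mult_le_0_iff)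
    qed
    then have "0 \<le> adj B \<delta> \<bullet> ?A u"
      by (rule tendsto_lowerbound[OF tendsto_inner[OF \<tau>lim hq]]) simp
    then show ?thesis
      by (metis \<delta>_eq adj_inner)
  qed
  moreover have "b \<bullet> u = 0"
    using ab(3) by (metis u_def adj_inner inner_zero_left)
  moreover have "a \<bullet> u \<le> 0"
    using ab(2) uK by (simp add: polar_def)
  \<comment> \<open>Since \<open>u\<close> is in the range of \<open>\<Phi>' xbar\<close>, the
    kernel element \<open>b\<close> is orthogonal to it; hence \<open>a \<bullet> u\<close> equals
    \<open>\<delta> \<bullet> u\<close> and is both nonnegative and nonpositive.\<close>
  ultimately have "a \<bullet> u = 0"
    by (simp add: ab(1) inner_diff_left)
  then have gd: "adj (h'' u) \<rho>0 + a \<in> graphical_derivative (normal_cone \<Theta>) ?z \<mu>bar u"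
    using red.mem_graphical_derivative[OF \<rho>0(1), of u a] uK ab(2) \<rho>0(2) by simp
  have "(\<lambda>k. (Psi f \<Phi> (xbar + t k *\<^sub>R \<xi> k) (\<mu> k) - Psi f \<Phi> xbar (\<mu> k)) /\<^sub>R t k + adj (\<Phi>' xbar) (\<eta> k))
    \<longlonglongrightarrow> nabla (\<lambda>u. Psi f \<Phi> u \<mu>bar) xbar \<xi>0 + adj (\<Phi>' xbar) \<eta>0"
    by (intro tendsto_add adj.tendsto \<eta> tendsto_const Psi_quotient[OF t \<xi> \<mu>])
  moreover have "Psi f \<Phi> xbar (\<mu> k) = t k *\<^sub>R adj (\<Phi>' xbar) (\<eta> k)" for k
    using Psi_diff_multiplier[of xbar "\<mu> k" "\<nu> k"] \<nu>(1)[of k]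
    by (simp add: multipliers_def \<mu>_def adj.scaleR_right)
  ultimately have "(\<lambda>k. Psi f \<Phi> (xbar + t k *\<^sub>R \<xi> k) (\<mu> k) /\<^sub>R t k)
    \<longlonglongrightarrow> nabla (\<lambda>u. Psi f \<Phi> u \<mu>bar) xbar \<xi>0 + adj (\<Phi>' xbar) \<eta>0"
    using t(2) by (simp add: scaleR_diff_right less_imp_neq[symmetric])
  then have "nabla (\<lambda>u. Psi f \<Phi> u \<mu>bar) xbar \<xi>0 + adj (\<Phi>' xbar) \<eta>0 = 0"
    using P unfolding \<mu>_def by (rule LIMSEQ_unique)
  \<comment> \<open>The constructed derivative element differs from \<open>\<eta>0\<close> by
    \<open>b\<close> alone, which the adjoint annihilates, so the limiting equation carries
    over.\<close>
  moreover have "adj (\<Phi>' xbar) (adj (h'' u) \<rho>0 + a) = adj (\<Phi>' xbar) \<eta>0"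
  proof -
    have "adj (h'' u) \<rho>0 + a = \<eta>0 + b"
      using ab(1) by (simp add: \<delta>_def algebra_simps)
    then show ?thesis
      by (simp add: adj.add_right ab(3))
  qed
  ultimately show "\<xi>0 = 0"
    using noncritical gd unfolding noncritical_def nabla_\<Phi> adj_def[symmetric] u_def
    by (metis (no_types, lifting) image_eqI)
qed

lemma noncritical_imp_semi_isolated_calm:
  assumes "cone_reduction \<Theta> N C h h' h'' (\<Phi> xbar)"
    and "closed (minkowski_diff (polar (critical_cone \<Theta> (\<Phi> xbar) \<mu>bar))
          (polar (critical_cone \<Theta> (\<Phi> xbar) \<mu>bar) \<inter> {\<eta>. adj (\<Phi>' xbar) \<eta> = 0}))"
    and "calm_at (multiplier_map f \<Phi> \<Theta> xbar) (0, 0) \<mu>bar"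
    and "noncritical f \<Phi> \<Theta> xbar \<mu>bar"
  shows "semi_isolated_calm f \<Phi> \<Theta> xbar \<mu>bar"
proof (rule ccontr)
  assume "\<not> semi_isolated_calm f \<Phi> \<Theta> xbar \<mu>bar"
  with assms(3) show False
  proof (rule not_semi_isolated_calm_directionsE)
    fix t :: "nat \<Rightarrow> real" and \<xi> \<xi>0 \<nu> \<eta> \<eta>0 w
    assume d: "t \<longlonglongrightarrow> 0" "\<And>k. 0 < t k" "\<xi> \<longlonglongrightarrow> \<xi>0" "\<eta> \<longlonglongrightarrow> \<eta>0" "w \<longlonglongrightarrow> 0"
      "\<And>k. \<nu> k \<in> multipliers f \<Phi> \<Theta> xbar" "\<nu> \<longlonglongrightarrow> \<mu>bar"
      "\<And>k. \<nu> k + t k *\<^sub>R \<eta> k \<in> normal_cone \<Theta> (\<Phi> (xbar + t k *\<^sub>R \<xi> k) + t k *\<^sub>R w k)"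
      "(\<lambda>k. Psi f \<Phi> (xbar + t k *\<^sub>R \<xi> k) (\<nu> k + t k *\<^sub>R \<eta> k) /\<^sub>R t k) \<longlonglongrightarrow> 0"
    assume "\<xi>0 \<noteq> 0"
    with noncritical_direction_eq_zero[OF assms(1,2,4) d] show False
      by contradiction
  qed
qed

end

section \<open>From cone reducibility to the reduction data, and assembly of the
  implications\<close>

lemma C2_cone_reducibleE:
  fixes \<Theta> :: "'y::euclidean_space set" and C :: "'e::euclidean_space set"
  assumes "C2_cone_reducible \<Theta> z C"
  obtains N h h' h'' where "cone_reduction \<Theta> N C h h' h'' z"
proof -
  obtain U h where *: "z \<in> \<Theta>" "closed C" "convex C" "cone C" "z \<in> interior U" "C2_smooth h"
    "\<Theta> \<inter> U = {y \<in> U. h y \<in> C}" "h z = (0 :: 'e)" "surj (nabla h z)"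
    using assms unfolding C2_cone_reducible_def by blast
  obtain h' :: "'y \<Rightarrow> 'y \<Rightarrow>\<^sub>L 'e" and h'' :: "'y \<Rightarrow> 'y \<Rightarrow>\<^sub>L 'y \<Rightarrow>\<^sub>L 'e"
    where h': "\<And>x. (h has_derivative blinfun_apply (h' x)) (at x)"
      and h'': "\<And>x. (h' has_derivative blinfun_apply (h'' x)) (at x)"
    using *(6) unfolding C2_smooth_def by blast
  have "continuous_on UNIV h'"
    using h'' has_derivative_continuous by (metis continuous_at_imp_continuous_on)
  moreover have "y \<in> \<Theta> \<longleftrightarrow> h y \<in> C" if "y \<in> interior U" for y
    using *(7) that interior_subset by blast
  moreover have "surj (blinfun_apply (h' z))"
    using *(9) frechet_derivative_at[OF h'[of z]] by simp
  ultimately have "cone_reduction \<Theta> (interior U) C h h' (blinfun_apply (h'' z)) z"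
    using * h' h'' by unfold_locales auto
  then show thesis
    by (rule that)
qed

theorem theorem5p6:
  fixes f :: "'x::euclidean_space \<Rightarrow> 'x"
    and \<Phi> :: "'x \<Rightarrow> 'y::euclidean_space"
    and \<Theta> :: "'y set"
    and C :: "'e::euclidean_space set"
    and xbar :: 'x and \<mu>bar :: 'y
  assumes "\<And>x. f differentiable (at x)"
    and "twice_differentiable \<Phi>"
    and "closed \<Theta>"
    and "solves_variational_system f \<Phi> \<Theta> xbar \<mu>bar"
  shows "((error_bound f \<Phi> \<Theta> xbar \<mu>bar \<longleftrightarrow> semi_isolated_calm f \<Phi> \<Theta> xbar \<mu>bar) \<and>
          (semi_isolated_calm f \<Phi> \<Theta> xbar \<mu>bar \<longrightarrow> noncritical f \<Phi> \<Theta> xbar \<mu>bar)) \<and>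
         (C2_cone_reducible \<Theta> (\<Phi> xbar) C \<longrightarrow>
          closed (minkowski_diff
                   (polar (critical_cone \<Theta> (\<Phi> xbar) \<mu>bar))
                   (polar (critical_cone \<Theta> (\<Phi> xbar) \<mu>bar) \<inter> {\<eta>. adjoint (nabla \<Phi> xbar) \<eta> = 0})) \<longrightarrow>
          calm_at (multiplier_map f \<Phi> \<Theta> xbar) (0, 0) \<mu>bar \<longrightarrow>
          noncritical f \<Phi> \<Theta> xbar \<mu>bar \<longrightarrow> semi_isolated_calm f \<Phi> \<Theta> xbar \<mu>bar)"
proof -
  obtain \<Phi>' where "\<And>x. (\<Phi> has_derivative blinfun_apply (\<Phi>' x)) (at x)" "\<And>x. \<Phi>' differentiable (at x)"
    using twice_differentiableE[OF assms(2)] by blast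
  then interpret variational_system f \<Phi> \<Phi>' \<Theta> xbar \<mu>bar
    using assms by unfold_locales (auto simp: multipliers_def solves_variational_system_def)
  show ?thesis
    using error_bound_imp_semi_isolated_calm semi_isolated_calm_imp_error_bound
      semi_isolated_calm_imp_noncritical noncritical_imp_semi_isolated_calm C2_cone_reducibleE[of \<Theta> "\<Phi> xbar" C]
    unfolding nabla_\<Phi> adj_def[symmetric] by metis
qed

end
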